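(* Let $$\mathcal S=\{n\in\mathbb Z_{>0}: S_r(n)\in\mathbb Z \text{ for some integer } r\ge 1\}$$ and $\mathcal S(x)=\mathcal S\cap[1,x]$. Then for every fixed real $A>0$ we have $\#\mathcal S(x)=O_A\!\left(x/(\log x)^A\right)$, i.e. there is a constant $C_A$ depending only on $A$ such that $\#\mathcal S(x)\le C_A\, x/(\log x)^A$ for all real $x\ge 2$. In particular, the reciprocal sum $\sum_{n\in\mathcal S}1/n$ is finite.
   Context: For positive integers $r,n$, $S_r(n)$ denotes the rational number $$S_r(n)=\sum_{k=1}^{n}\frac{k}{k+r}\binom{n}{k}.$$ *)

theory Defs
  imports "HOL-Analysis.Analysis"
begin

definition S_sum :: "nat \<Rightarrow> nat \<Rightarrow> rat" where
  "S_sum r n = (\<Sum>k=1..n. of_nat k / of_nat (k + r) * of_nat (n choose k))"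

definition S_set :: "nat set" where
  "S_set = {n. n > 0 \<and> (\<exists>r\<ge>1. S_sum r n \<in> \<int>)}"

definition S_upto :: "real \<Rightarrow> nat set" where
  "S_upto x = {n \<in> S_set. real n \<in> {1..x}}"

end

theory Submission
  imports Defs "HOL-Number_Theory.Number_Theory" "HOL-Real_Asymp.Real_Asymp"
begin

text \<open>Write $S_r(n) = 2^n - r T(n,r)$ with $T(n,r) = \sum_k (n choose k) / (k + r)$. Suppose that
  $S_r(n)$ is an integer.

  A prime $p > n$ cannot divide $(n+r choose n)$, and for $r$ of the order of $n$ Lucas' theorem shows that
  no prime $p > \eta n$ can, since the sum modulo $p$ reduces to a positive integer that is bounded in terms
  of $\eta$. Comparing lower bounds for $(n+r choose n)$ with Chebyshev's upper bound for the number of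
  primes (each prime power dividing $(n+r choose n)$ is at most $n+r$) leaves only $r < n / e^{12}$
  for large $n$.

  Since $T(n,r)$ is an alternating combination of the numbers $(2^N - 1) / N$ with $n < N \le n + r$, every
  prime $p > r$ dividing such an $N$ also divides $2^N - 1$. Then $p \cdot \mathrm{ord}_p(2)$ divides $N$,
  and few $N$ have this property for some $p > z$, where $z$ is a power of $\log x$. If $r < z$, then $n + 1$ is
  $z$-smooth, which is rare by Rankin's method, or it is one of these $N$. If $r \ge z$, then the size of
  $(n+r choose r)$ forces a proportion at least $1 / \log (n+r)$ of the interval $(n, n+r]$ to consist of
  such $N$, and a covering argument bounds the number of these $n$.\<close>

section \<open>Prime counting\<close>

text \<open>The shift \<open>r\<close> is not bounded in terms of \<open>n\<close>, so all estimates
  have to be uniform in it. Two expressions for the sum share the work: one has the \<open>n\<close>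
  consecutive denominators r+1, ..., r+n, the other the \<open>r\<close> consecutive denominators
  n+1, ..., n+r. A prime exceeding the number of denominators divides at most one of them and must
  divide the numerator above it.

  Both size comparisons set the lower bound ((n+r)/k)^k for a binomial coefficient against a power
  of n+r, with k = n and k = r. With Chebyshev's constant 5, they lose the same factor e^12. The
  case k = r therefore contradicts nothing unless n \<ge> e^12 r, while k = n only yields n + r
  \<le> e^12 n. The gap between these ranges is the reason for the treatment of \<open>r\<close> of
  the order of \<open>n\<close>: there all primes up to \<open>n\<close> are too many for a
  contradiction, but those up to \<eta> n with small \<eta> are not.

  The density 1/log(n+r) costs a factor log x in the covering, so z = w^2 is taken with w about (log
  x)^(A+1).\<close>

definition prime_count :: "nat \<Rightarrow> nat" where
  "prime_count n = card {p. prime p \<and> p \<le> n}"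

lemma finite_primes_le [simp]: "finite {p::nat. prime p \<and> p \<le> n}"
  by (rule finite_subset[of _ "{..n}"]) auto

lemma prod_primes_dvd:
  fixes A :: "nat set"
  assumes "finite A" "\<And>p. p \<in> A \<Longrightarrow> prime p" "\<And>p. p \<in> A \<Longrightarrow> p dvd N"
  shows "\<Prod>A dvd N"
  using assms
proof (induction A rule: finite_induct)
  case (insert p A)
  have "coprime p (\<Prod>A)"
    using insert by (intro prod_coprime_right) (metis insertCI primes_coprime)
  then show ?case
    using insert by (simp add: divides_mult)
qed auto

text \<open>Erdos' argument: for n = 2m+1 the primes in (m+1, n] all divide
  \<open>2 * m + 1 choose m\<close>, and the primes up to m+1 are left to the induction.\<close>

lemma primorial_le: "\<Prod>{p::nat. prime p \<and> p \<le> n} \<le> 4 ^ n"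
proof (induction n rule: less_induct)
  case (less n)
  consider "n \<le> 1" | "n = 2" | "n > 2" "even n" | m where "n = 2 * m + 1" "m \<ge> 1"
  proof -
    have "n \<le> 1 \<or> n = 2 \<or> (n > 2 \<and> even n) \<or> (\<exists>m. n = 2 * m + 1 \<and> m \<ge> 1)"
    proof (cases "even n")
      case False
      then obtain m where "n = 2 * m + 1" by (rule oddE)
      then show ?thesis by (cases "m = 0") auto
    qed auto
    then show ?thesis using that by blast
  qed
  then show ?case
  proof cases
    case 1
    then have "{p::nat. prime p \<and> p \<le> n} = {}"
      by (auto dest: prime_ge_2_nat)
    then show ?thesis by (simp only:) simp
  next
    case 2
    have "{p::nat. prime p \<and> p \<le> 2} = {2}"
      by (auto dest: prime_ge_2_nat)
    then show ?thesis using 2 by simp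
  next
    case 3
    have "\<not> prime n" using 3 primes_dvd_imp_eq two_is_prime_nat by blast
    then have "{p::nat. prime p \<and> p \<le> n} = {p. prime p \<and> p \<le> n - 1}"
      by (auto simp: le_less)
    moreover have "\<Prod>{p::nat. prime p \<and> p \<le> n - 1} \<le> 4 ^ (n - 1)"
      using 3 by (intro less) auto
    moreover have "(4::nat) ^ (n - 1) \<le> 4 ^ n" by (intro power_increasing) auto
    ultimately show ?thesis by (metis order_trans)
  next
    case (4 m)
    define B where "B = {p::nat. prime p \<and> m + 1 < p \<and> p \<le> n}"
    have fin: "finite B"
      unfolding B_def by (rule finite_subset[of _ "{..n}"]) auto
    have eq: "{p::nat. prime p \<and> p \<le> n} = {p. prime p \<and> p \<le> m + 1} \<union> B"
      unfolding B_def using 4 by auto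
    have "\<Prod>{p::nat. prime p \<and> p \<le> n} = \<Prod>{p. prime p \<and> p \<le> m + 1} * \<Prod>B"
      unfolding eq by (rule prod.union_disjoint) (use fin in \<open>auto simp: B_def\<close>)
    moreover have "\<Prod>{p::nat. prime p \<and> p \<le> m + 1} \<le> 4 ^ (m + 1)"
      using 4 by (intro less) auto
    moreover have "\<Prod>B \<le> 4 ^ m"
    proof -
      have "\<Prod>B dvd (2 * m + 1 choose m)"
      proof (rule prod_primes_dvd[OF fin])
        fix p assume p: "p \<in> B"
        show "prime p" using p by (simp add: B_def)
        have "fact m * fact (2 * m + 1 - m) * (2 * m + 1 choose m) = (fact (2 * m + 1) :: nat)"
          by (rule binomial_fact_lemma) simp
        moreover have "p dvd (fact (2 * m + 1) :: nat)"
          using p 4 by (simp add: B_def prime_dvd_fact_iff del: fact_Suc)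
        ultimately have "p dvd fact m * fact (2 * m + 1 - m) * (2 * m + 1 choose m)" by simp
        then have "p dvd (fact m :: nat) \<or> p dvd (fact (2 * m + 1 - m) :: nat) \<or> p dvd (2 * m + 1 choose m)"
          using \<open>prime p\<close> prime_dvd_mult_iff by blast
        moreover have "\<not> p dvd (fact m :: nat)" "\<not> p dvd (fact (2 * m + 1 - m) :: nat)"
          using p by (simp_all add: B_def prime_dvd_fact_iff del: fact_Suc)
        ultimately show "p dvd (2 * m + 1 choose m)" by blast
      qed
      then have "\<Prod>B \<le> (2 * m + 1 choose m)"
        by (rule dvd_imp_le) simp
      \<comment> \<open>By symmetry the lower half of row 2m+1 sums to 4^m.\<close>
      also have "\<dots> \<le> (\<Sum>k\<le>m. (2 * m + 1 choose k))"
        by (rule member_le_sum) auto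
      also have "\<dots> = 4 ^ m"
        by (subst binomial_r_part_sum) (simp add: power_mult)
      finally show ?thesis .
    qed
    ultimately have "\<Prod>{p::nat. prime p \<and> p \<le> n} \<le> 4 ^ (m + 1) * 4 ^ m"
      by (simp add: mult_le_mono)
    also have "\<dots> = 4 ^ n" using 4 by (simp add: power_add[symmetric] mult_2)
    finally show ?thesis .
  qed
qed

lemma ln4_le: "ln (4::real) \<le> 3/2"
proof -
  have "ln (4::real) = 2 * ln 2" using ln_realpow[of 2 2] by simp
  then show ?thesis using ln2_le_25_over_36 by simp
qed

text \<open>The constant is 5 = 2 + 3. There are at most sqrt n primes below sqrt n, which is at
  most 2n / ln n since ln n \<le> 2 sqrt n. Each larger prime contributes a factor sqrt n to the
  primorial, so there are at most 2n ln 4 / ln n \<le> 3n / ln n of them.\<close>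

lemma prime_count_le:
  assumes "n \<ge> 2"
  shows "real (prime_count n) \<le> 5 * real n / ln (real n)"
proof -
  define s where "s = nat \<lfloor>sqrt (real n)\<rfloor>"
  define B where "B = {p::nat. prime p \<and> s < p \<and> p \<le> n}"
  have n: "real n \<ge> 2" using assms by simp
  have lnn: "ln (real n) > 0" using n by simp
  have fin: "finite B"
    unfolding B_def by (rule finite_subset[of _ "{..n}"]) auto
  have "{p::nat. prime p \<and> p \<le> n} \<subseteq> {1..s} \<union> B"
    using prime_ge_1_nat by (auto simp: B_def not_le)
  then have "prime_count n \<le> card ({1..s} \<union> B)"
    unfolding prime_count_def using fin by (intro card_mono) auto
  also have "\<dots> \<le> s + card B"
    using card_Un_le[of "{1..s}" B] by simp
  finally have 1: "prime_count n \<le> s + card B" .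
  have sq: "sqrt (real n) * sqrt (real n) = real n" by simp
  have "ln (sqrt (real n)) \<le> sqrt (real n)"
    using ln_bound[of "sqrt (real n)"] n by simp
  then have l: "ln (real n) \<le> 2 * sqrt (real n)" using n by (simp add: ln_sqrt)
  have "real s \<le> sqrt (real n)" unfolding s_def by simp
  moreover have "sqrt (real n) * ln (real n) \<le> 2 * real n"
  proof -
    have "sqrt (real n) * ln (real n) \<le> sqrt (real n) * (2 * sqrt (real n))"
      using l by (intro mult_left_mono) auto
    also have "\<dots> = 2 * (sqrt (real n) * sqrt (real n))" by (rule mult.left_commute)
    finally show ?thesis by (simp only: sq)
  qed
  ultimately have 2: "real s * ln (real n) \<le> 2 * real n"
    using lnn by (smt (verit, best) mult_right_mono)
  have "(sqrt (real n)) ^ card B \<le> 4 ^ n"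
  proof -
    have "(sqrt (real n)) ^ card B = (\<Prod>p\<in>B. sqrt (real n))" by simp
    also have "\<dots> \<le> (\<Prod>p\<in>B. real p)"
    proof (rule prod_mono)
      fix p assume "p \<in> B"
      then have "real p \<ge> real s + 1" by (simp add: B_def)
      moreover have "sqrt (real n) \<le> real s + 1" unfolding s_def by linarith
      ultimately show "0 \<le> sqrt (real n) \<and> sqrt (real n) \<le> real p" by simp
    qed
    also have "\<dots> = real (\<Prod>B)" by simp
    also have "\<Prod>B \<le> \<Prod>{p::nat. prime p \<and> p \<le> n}"
      by (intro dvd_imp_le prod_dvd_prod_subset) (auto simp: B_def intro: prod_pos prime_gt_0_nat)
    then have "real (\<Prod>B) \<le> real (4 ^ n)"
      using primorial_le[of n] of_nat_mono order_trans by blast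
    finally show ?thesis by simp
  qed
  then have "ln ((sqrt (real n)) ^ card B) \<le> ln (4 ^ n)"
    using n by (subst ln_le_cancel_iff) auto
  then have "real (card B) * (ln (real n) / 2) \<le> real n * ln 4"
    using n by (simp add: ln_realpow ln_sqrt)
  moreover have "real n * ln 4 \<le> real n * (3/2)"
    using ln4_le by (intro mult_left_mono) auto
  ultimately have 3: "real (card B) * ln (real n) \<le> 3 * real n" by simp
  have "real (prime_count n) * ln (real n) \<le> (real s + real (card B)) * ln (real n)"
    using 1 lnn by (intro mult_right_mono) linarith+
  also have "\<dots> \<le> 5 * real n" using 2 3 by (simp add: algebra_simps)
  finally show ?thesis using lnn by (simp add: field_simps)
qed

section \<open>Prime power divisors of binomial coefficients\<close>

text \<open>The reciprocals of $k (n choose k)$ form the Leibniz harmonic triangle, in which each entry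
  is the difference of two entries with smaller $k$.\<close>

lemma leibniz_triangle:
  assumes "0 < k" "k < n"
  shows "1 / (of_nat (Suc k * (n choose Suc k)) :: rat) =
    1 / of_nat (k * ((n - 1) choose k)) - 1 / of_nat (k * (n choose k))"
proof -
  have e1: "Suc k * (n choose Suc k) = n * ((n - 1) choose k)" by (rule binomial_absorption)
  have e2: "(n - k) * (n choose k) = n * ((n - 1) choose k)" by (rule binomial_absorb_comp)
  define a b where "a = (of_nat ((n - 1) choose k) :: rat)" and "b = (of_nat (n choose k) :: rat)"
  have pos: "a \<noteq> 0" "b \<noteq> 0" "of_nat k \<noteq> (0::rat)" "of_nat n \<noteq> (0::rat)"
    using assms by (auto simp: a_def b_def)
  have e2': "(of_nat n - of_nat k) * b = of_nat n * a"
  proof -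
    have "of_nat ((n - k) * (n choose k)) = (of_nat (n * ((n - 1) choose k)) :: rat)"
      using e2 by simp
    then show ?thesis using assms by (simp add: of_nat_diff a_def b_def)
  qed
  have "1 / (of_nat (Suc k * (n choose Suc k)) :: rat) = 1 / (of_nat n * a)"
    unfolding e1 by (simp add: a_def)
  also have "\<dots> = 1 / (of_nat k * a) - 1 / (of_nat k * b)"
  proof -
    have "of_nat k * b = of_nat n * b - of_nat n * a"
      using e2' by (simp add: algebra_simps)
    then show ?thesis using pos by (simp add: field_simps)
  qed
  finally show ?thesis by (simp add: a_def b_def)
qed

text \<open>Repeated use of the triangle writes the reciprocal of \<open>k * (n choose k)\<close> as
  an integer combination of the 1/i with n-k < i \<le> n, and any common multiple \<open>D\<close>
  of these i clears all of them.\<close>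

lemma mult_binomial_dvd:
  assumes "0 < k" "k \<le> n" "\<And>i. n - k < i \<Longrightarrow> i \<le> n \<Longrightarrow> i dvd D"
  shows "k * (n choose k) dvd D"
  using assms
proof (induction k arbitrary: n)
  case (Suc k)
  show ?case
  proof (cases "k = 0")
    case True
    then show ?thesis using Suc.prems by simp
  next
    case False
    have "k * ((n - 1) choose k) dvd D"
      using Suc.prems False by (intro Suc.IH) auto
    then obtain e where e: "D = k * ((n - 1) choose k) * e" by (auto elim: dvdE)
    have "k * (n choose k) dvd D"
      using Suc.prems False by (intro Suc.IH) auto
    then obtain f where f: "D = k * (n choose k) * f" by (auto elim: dvdE)
    define x y z where "x = (of_nat (Suc k * (n choose Suc k)) :: rat)"
      and "y = (of_nat (k * ((n - 1) choose k)) :: rat)" and "z = (of_nat (k * (n choose k)) :: rat)"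
    have nz: "x \<noteq> 0" "y \<noteq> 0" "z \<noteq> 0"
      unfolding x_def y_def z_def of_nat_eq_0_iff using Suc.prems False by auto
    have "1 / x = 1 / y - 1 / z"
      unfolding x_def y_def z_def using Suc.prems False by (intro leibniz_triangle) auto
    moreover have "of_nat D = y * of_nat e" "of_nat D = z * of_nat f"
      unfolding y_def z_def by (subst e, simp, subst f, simp)
    then have "of_nat D * (1 / y) = of_nat e" "of_nat D * (1 / z) = of_nat f"
      using nz by (simp_all add: field_simps)
    ultimately have "of_nat D * (1 / x) = of_nat e - of_nat f"
      by (simp only: right_diff_distrib)
    then have "of_nat D = x * (of_nat e - of_nat f)" using nz by (simp add: field_simps)
    then have "rat_of_int (int D) = of_int (int (Suc k * (n choose Suc k)) * (int e - int f))"
      unfolding x_def by simp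
    then have "int D = int (Suc k * (n choose Suc k)) * (int e - int f)"
      by (simp only: of_int_eq_iff)
    then have "int (Suc k * (n choose Suc k)) dvd int D" by simp
    then show ?thesis by (simp only: int_dvd_int_iff)
  qed
qed simp

lemma finite_power_le: "finite {e. (p::nat) ^ e \<le> n}" if "p > Suc 0"
  by (rule finite_subset[of _ "{..n}"]) (use power_gt_expt[OF that] in \<open>force intro: less_imp_le less_le_trans\<close>, simp)

text \<open>The product is lcm(1, ..., n), spelled out through its prime powers.\<close>

lemma dvd_prod_max_prime_powers:
  fixes n i :: nat
  assumes "0 < i" "i \<le> n"
  shows "i dvd (\<Prod>p | prime p \<and> p \<le> n. p ^ (Max {e. p ^ e \<le> n}))"
proof -
  have "i = (\<Prod>p\<in>prime_factors i. p ^ multiplicity p i)"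
    using assms by (simp add: prime_factorization_nat)
  also have "\<dots> dvd (\<Prod>p\<in>prime_factors i. p ^ (Max {e. p ^ e \<le> n}))"
  proof (rule prod_dvd_prod)
    fix p assume p: "p \<in># prime_factorization i"
    have "p ^ multiplicity p i \<le> i"
      using assms by (intro dvd_imp_le multiplicity_dvd) auto
    moreover have "finite {e. p ^ e \<le> n}"
      using p by (intro finite_power_le) (auto simp: in_prime_factors_iff prime_gt_Suc_0_nat)
    ultimately have "multiplicity p i \<le> Max {e. p ^ e \<le> n}"
      using assms by (intro Max_ge) auto
    then show "p ^ multiplicity p i dvd p ^ (Max {e. p ^ e \<le> n})" by (rule le_imp_power_dvd)
  qed
  also have "\<dots> dvd (\<Prod>p | prime p \<and> p \<le> n. p ^ (Max {e. p ^ e \<le> n}))"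
    using assms by (intro prod_dvd_prod_subset)
      (auto simp: in_prime_factors_iff dest!: dvd_imp_le)
  finally show ?thesis .
qed

text \<open>With \<open>D\<close> = lcm(1, ..., n) in \<open>mult_binomial_dvd\<close>, the prime
  power divides this lcm, whose \<open>p\<close>-part is at most \<open>n\<close>. Primes above
  \<open>n\<close> do not occur in the lcm and are excluded by the factorial.\<close>

lemma prime_power_dvd_binomial_le:
  fixes p :: nat
  assumes "prime p" "p ^ e dvd (n choose k)" "0 < k" "k \<le> n"
  shows "p ^ e \<le> n"
proof (cases "p \<le> n")
  case False
  have "(n choose k) dvd fact n"
    using binomial_fact_lemma[OF assms(4)] by (metis dvd_triv_right)
  then have "p ^ e dvd (fact n :: nat)" using assms dvd_trans by blast
  moreover have "\<not> p dvd (fact n :: nat)"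
    using False assms by (simp add: prime_dvd_fact_iff)
  ultimately have "e = 0" by (metis dvd_power dvd_trans gr0I)
  then show ?thesis using assms by simp
next
  case True
  define M where "M q = Max {e. q ^ e \<le> n}" for q
  let ?D = "\<Prod>q | prime q \<and> q \<le> n. q ^ M q"
  have "k * (n choose k) dvd ?D"
    unfolding M_def using assms by (intro mult_binomial_dvd dvd_prod_max_prime_powers) auto
  then have "p ^ e dvd ?D" using assms by (meson dvd_mult dvd_trans)
  also have "?D = p ^ M p * (\<Prod>q\<in>{q. prime q \<and> q \<le> n} - {p}. q ^ M q)"
    using True assms by (subst prod.remove[of _ p]) auto
  finally have "p ^ e dvd p ^ M p * (\<Prod>q\<in>{q. prime q \<and> q \<le> n} - {p}. q ^ M q)" .
  moreover have "coprime (p ^ e) (\<Prod>q\<in>{q. prime q \<and> q \<le> n} - {p}. q ^ M q)"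
    using assms by (intro prod_coprime_right) (auto intro: primes_coprime)
  ultimately have "p ^ e dvd p ^ M p" by (simp add: coprime_dvd_mult_left_iff)
  then have le: "p ^ e \<le> p ^ M p" using assms by (intro dvd_imp_le) (auto simp: prime_gt_0_nat)
  have "M p \<in> {e. p ^ e \<le> n}"
    unfolding M_def
  proof (rule Max_in)
    show "{e. p ^ e \<le> n} \<noteq> {}" using assms by (auto intro: exI[of _ 0])
    show "finite {e. p ^ e \<le> n}"
      using assms by (intro finite_power_le) (simp add: prime_gt_Suc_0_nat)
  qed
  then show ?thesis using le by simp
qed

text \<open>Whatever its multiplicity, a prime costs at most a factor \<open>n\<close>. All size
  comparisons below rest on this.\<close>

lemma divisor_binomial_le:
  assumes "X dvd (n choose k)" "0 < k" "k \<le> n" "finite P" "prime_factors X \<subseteq> P"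
  shows "X \<le> n ^ card P"
proof -
  have X: "X \<noteq> 0" using assms by (auto intro!: Nat.gr0I)
  have "X = (\<Prod>p\<in>prime_factors X. p ^ multiplicity p X)"
    using X by (simp add: prime_factorization_nat)
  also have "\<dots> \<le> (\<Prod>p\<in>prime_factors X. n)"
  proof (rule prod_mono)
    fix p assume p: "p \<in> prime_factors X"
    have "p ^ multiplicity p X dvd (n choose k)" using assms(1) multiplicity_dvd dvd_trans by blast
    then show "0 \<le> p ^ multiplicity p X \<and> p ^ multiplicity p X \<le> n"
      using prime_power_dvd_binomial_le[of p "multiplicity p X" n k] p assms
      by (auto simp: in_prime_factors_iff)
  qed
  also have "\<dots> = n ^ card (prime_factors X)" by simp
  also have "\<dots> \<le> n ^ card P"
    using assms by (intro power_increasing card_mono) auto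
  finally show ?thesis .
qed

section \<open>Integrality conditions modulo primes\<close>

lemma prod_times_sum_fractions_Ints:
  fixes a :: "'i \<Rightarrow> int" and d :: "'i \<Rightarrow> nat"
  assumes "finite A" "\<And>i. i \<in> A \<Longrightarrow> d i \<noteq> 0"
  shows "of_nat (\<Prod>i\<in>A. d i) * (\<Sum>i\<in>A. of_int (a i) / of_nat (d i)) \<in> (\<int> :: rat set)"
proof -
  have "of_nat (\<Prod>i\<in>A. d i) * (of_int (a i) / of_nat (d i)) \<in> (\<int> :: rat set)" if "i \<in> A" for i
  proof -
    have "(\<Prod>i\<in>A. d i) = d i * (\<Prod>i\<in>A-{i}. d i)"
      using assms that by (intro prod.remove) auto
    then have "of_nat (\<Prod>i\<in>A. d i) * (of_int (a i) / of_nat (d i)) =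
        (of_int (int (\<Prod>i\<in>A-{i}. d i) * a i) :: rat)"
      using assms(2)[OF that] by simp
    then show ?thesis by (metis Ints_of_int)
  qed
  then show ?thesis by (subst sum_distrib_left) (rule Ints_sum)
qed

text \<open>\<open>Q\<close> is the product of the denominators outside \<open>B\<close>, which are
  prime to \<open>p\<close>; it makes the part of the sum outside \<open>B\<close> integral.\<close>

lemma clear_denominators:
  fixes a :: "'i \<Rightarrow> int" and d :: "'i \<Rightarrow> nat"
  assumes "finite A" "B \<subseteq> A" "prime p" "\<And>i. i \<in> A - B \<Longrightarrow> \<not> p dvd d i"
    and int: "(\<Sum>i\<in>A. of_int (a i) / of_nat (d i)) \<in> (\<int> :: rat set)"
  obtains Q :: nat where "\<not> p dvd Q"
    "of_nat Q * (\<Sum>i\<in>B. of_int (a i) / of_nat (d i)) \<in> (\<int> :: rat set)"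
proof
  let ?f = "\<lambda>i. of_int (a i) / (of_nat (d i) :: rat)"
  let ?Q = "\<Prod>i\<in>A-B. d i"
  show "\<not> p dvd ?Q"
    using assms by (subst prime_dvd_prod_iff) auto
  have "d i \<noteq> 0" if "i \<in> A - B" for i
    using assms(4)[OF that] by (cases "d i = 0") auto
  then have "of_nat ?Q * sum ?f (A - B) \<in> \<int>"
    using assms(1) by (intro prod_times_sum_fractions_Ints) auto
  moreover have "of_nat ?Q * sum ?f A \<in> \<int>" using int by (intro Ints_mult) auto
  ultimately have "of_nat ?Q * sum ?f A - of_nat ?Q * sum ?f (A - B) \<in> \<int>" by (rule Ints_diff[rotated])
  also have "of_nat ?Q * sum ?f A - of_nat ?Q * sum ?f (A - B) = of_nat ?Q * sum ?f B"
    using assms(1,2) by (subst sum.subset_diff[of B A]) (auto simp: algebra_simps)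
  finally show "of_nat ?Q * sum ?f B \<in> \<int>" .
qed

text \<open>No other term can cancel the factor \<open>p\<close> in the denominator
  \<open>d i\<close>, so the numerator above it has to.\<close>

lemma prime_dvd_single_numerator:
  fixes a :: "'i \<Rightarrow> int" and d :: "'i \<Rightarrow> nat"
  assumes "finite A" "i \<in> A" "prime p" "p dvd d i" "d i \<noteq> 0"
    and "\<And>j. j \<in> A \<Longrightarrow> j \<noteq> i \<Longrightarrow> \<not> p dvd d j"
    and "(\<Sum>i\<in>A. of_int (a i) / of_nat (d i)) \<in> (\<int> :: rat set)"
  shows "int p dvd a i"
proof -
  obtain Q where Q: "\<not> p dvd Q"
    "of_nat Q * (\<Sum>i\<in>{i}. of_int (a i) / of_nat (d i)) \<in> (\<int> :: rat set)"
    by (rule clear_denominators[of A "{i}" p d a]) (use assms in auto)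
  then obtain z where "of_nat Q * (of_int (a i) / of_nat (d i)) = (of_int z :: rat)"
    by (auto elim: Ints_cases)
  then have "of_int (int Q * a i) = (of_int (z * int (d i)) :: rat)"
    using assms(5) by (simp add: field_simps)
  then have "int Q * a i = z * int (d i)" by (simp only: of_int_eq_iff)
  then have "int p dvd int Q * a i"
    using assms(4) by simp
  moreover have "\<not> int p dvd int Q" using Q(1) by simp
  moreover have "prime (int p)" using assms(3) by simp
  ultimately show ?thesis using prime_dvd_multD by blast
qed

text \<open>For r \<ge> 1 this is the integral of x^(r-1) (1+x)^n over [0, 1]. Expanding x^(r-1) in
  powers of 1+x instead of (1+x)^n in powers of x leads to the second expression, with denominators
  n+1, ..., n+r.\<close>

definition recip_sum :: "nat \<Rightarrow> nat \<Rightarrow> rat" where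
  "recip_sum n r = (\<Sum>k\<le>n. of_nat (n choose k) / of_nat (k + r))"

lemma S_sum_eq:
  assumes "r \<ge> 1"
  shows "S_sum r n = 2 ^ n - of_nat r * recip_sum n r"
proof -
  have "S_sum r n = (\<Sum>k\<le>n. of_nat k / of_nat (k + r) * of_nat (n choose k))"
    unfolding S_sum_def by (rule sum.mono_neutral_left) auto
  also have "\<dots> = (\<Sum>k\<le>n. of_nat (n choose k) - of_nat r * (of_nat (n choose k) / of_nat (k + r)))"
  proof (rule sum.cong)
    fix k
    have "of_nat k / of_nat (k + r) = 1 - of_nat r / (of_nat (k + r) :: rat)"
      using assms by (simp add: field_simps)
    then show "of_nat k / of_nat (k + r) * of_nat (n choose k) =
        of_nat (n choose k) - of_nat r * (of_nat (n choose k) / (of_nat (k + r) :: rat))"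
      by (simp only:) (simp add: algebra_simps)
  qed simp
  also have "\<dots> = of_nat (\<Sum>k\<le>n. n choose k) - of_nat r * recip_sum n r"
    by (simp add: sum_subtractf recip_sum_def sum_distrib_left)
  also have "(\<Sum>k\<le>n. n choose k) = 2 ^ n" by (rule choose_row_sum)
  finally show ?thesis by simp
qed

lemma S_sum_Ints_iff:
  assumes "r \<ge> 1"
  shows "S_sum r n \<in> \<int> \<longleftrightarrow> of_nat r * recip_sum n r \<in> \<int>"
proof -
  have e: "of_nat r * recip_sum n r = 2 ^ n - S_sum r n" using S_sum_eq[OF assms] by simp
  have "(2::rat) ^ n \<in> \<int>" by simp
  then show ?thesis using S_sum_eq[OF assms] e by (metis Ints_diff)
qed

text \<open>Pascal's rule, or x^(r-1) (1+x) = x^(r-1) + x^r under the integral.\<close>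

lemma recip_sum_Suc:
  assumes "r \<ge> 1"
  shows "recip_sum (Suc n) r = recip_sum n r + recip_sum n (Suc r)"
proof -
  have "recip_sum (Suc n) r = 1 / of_nat r +
      (\<Sum>k\<le>n. of_nat (n choose k) / of_nat (k + Suc r) + of_nat (n choose Suc k) / of_nat (Suc k + r))"
    unfolding recip_sum_def by (subst sum.atMost_Suc_shift) (simp add: add_divide_distrib)
  also have "\<dots> = recip_sum n (Suc r) +
      (1 / of_nat r + (\<Sum>k\<le>n. of_nat (n choose Suc k) / of_nat (Suc k + r)))"
    by (simp add: recip_sum_def sum.distrib)
  also have "1 / of_nat r + (\<Sum>k\<le>n. of_nat (n choose Suc k) / of_nat (Suc k + r)) =
      (\<Sum>k\<le>Suc n. of_nat (n choose k) / (of_nat (k + r) :: rat))"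
    by (subst sum.atMost_Suc_shift) simp
  also have "\<dots> = recip_sum n r" by (simp add: recip_sum_def)
  finally show ?thesis by simp
qed

lemma recip_sum_1: "recip_sum n 1 = (2 ^ (n + 1) - 1) / of_nat (n + 1)"
proof -
  have "recip_sum n 1 = (\<Sum>k\<le>n. of_nat (Suc n choose Suc k) / of_nat (Suc n))"
    unfolding recip_sum_def
  proof (rule sum.cong)
    fix k
    have "of_nat (Suc k * (Suc n choose Suc k)) = (of_nat (Suc n * (n choose k)) :: rat)"
      by (simp only: Suc_times_binomial)
    then show "of_nat (n choose k) / of_nat (k + 1) =
        (of_nat (Suc n choose Suc k) / of_nat (Suc n) :: rat)"
      by (simp add: field_simps del: binomial_Suc_Suc)
  qed simp
  also have "\<dots> = of_nat (\<Sum>k\<le>n. Suc n choose Suc k) / of_nat (Suc n)"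
    by (simp add: sum_divide_distrib del: binomial_Suc_Suc)
  also have "of_nat (\<Sum>k\<le>n. Suc n choose Suc k) = (2 ^ (n + 1) - 1 :: rat)"
  proof -
    have "1 + (\<Sum>k\<le>n. Suc n choose Suc k) = 2 ^ Suc n"
      using choose_row_sum[of "Suc n"] by (subst (asm) sum.atMost_Suc_shift) simp
    then have "of_nat (1 + (\<Sum>k\<le>n. Suc n choose Suc k)) = (of_nat (2 ^ Suc n) :: rat)"
      by (simp only:)
    then show ?thesis by (simp del: binomial_Suc_Suc)
  qed
  finally show ?thesis by simp
qed

text \<open>Pascal's rule again, as the recursion for iterated finite differences.\<close>

lemma binomial_transform_diff:
  fixes h :: "nat \<Rightarrow> 'a::comm_ring_1"
  shows "(\<Sum>j\<le>Suc r. (- 1) ^ (Suc r + j) * of_nat (Suc r choose j) * h j) =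
    (\<Sum>j\<le>r. (- 1) ^ (r + j) * of_nat (r choose j) * h (Suc j)) -
    (\<Sum>j\<le>r. (- 1) ^ (r + j) * of_nat (r choose j) * h j)"
proof -
  define U where "U = (\<Sum>j\<le>Suc r. (- 1) ^ (Suc r + j) * of_nat (r choose j) * h j)"
  have "U = - (\<Sum>j\<le>r. (- 1) ^ (r + j) * of_nat (r choose j) * h j)"
    unfolding U_def by (subst sum.atMost_Suc) (simp only: binomial_eq_0 lessI, simp add: sum_negf)
  moreover have "U = (- 1) ^ Suc r * h 0 +
      (\<Sum>j\<le>r. (- 1) ^ (r + j) * of_nat (r choose Suc j) * h (Suc j))"
    unfolding U_def by (subst sum.atMost_Suc_shift) simp
  moreover have "(\<Sum>j\<le>Suc r. (- 1) ^ (Suc r + j) * of_nat (Suc r choose j) * h j) =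
      (- 1) ^ Suc r * h 0 +
      (\<Sum>j\<le>r. (- 1) ^ (r + j) * of_nat (r choose Suc j) * h (Suc j)) +
      (\<Sum>j\<le>r. (- 1) ^ (r + j) * of_nat (r choose j) * h (Suc j))"
    by (subst sum.atMost_Suc_shift) (simp add: sum.distrib algebra_simps)
  ultimately show ?thesis by simp
qed

text \<open>By \<open>recip_sum_Suc\<close>, raising the shift by one takes a forward difference in
  \<open>n\<close>. Starting from \<open>recip_sum_1\<close>, the value at \<open>Suc r\<close> is
  the \<open>r\<close>-th difference of (2^N - 1)/N at N = n+1.\<close>

lemma recip_sum_closed_form:
  "recip_sum n (Suc r) =
    (\<Sum>j\<le>r. (- 1) ^ (r + j) * of_nat (r choose j) * ((2 ^ (n + j + 1) - 1) / of_nat (n + j + 1)))"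
proof (induction r arbitrary: n)
  case 0
  then show ?case using recip_sum_1 by simp
next
  case (Suc r)
  let ?h = "\<lambda>j. (2 ^ (n + j + 1) - 1) / (of_nat (n + j + 1) :: rat)"
  have "recip_sum n (Suc (Suc r)) = recip_sum (Suc n) (Suc r) - recip_sum n (Suc r)"
    using recip_sum_Suc[of "Suc r" n] by simp
  also have "recip_sum (Suc n) (Suc r) = (\<Sum>j\<le>r. (- 1) ^ (r + j) * of_nat (r choose j) * ?h (Suc j))"
    by (subst Suc.IH) (simp only: add_Suc add_Suc_right)
  also have "recip_sum n (Suc r) = (\<Sum>j\<le>r. (- 1) ^ (r + j) * of_nat (r choose j) * ?h j)"
    by (rule Suc.IH)
  also note binomial_transform_diff[of r ?h, symmetric]
  finally show ?case .
qed

section \<open>Divisibility forced by the integrality of the sum\<close>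

lemma prime_not_dvd_binomial:
  fixes p :: nat
  assumes "prime p" "m < p" "k \<le> m"
  shows "\<not> p dvd (m choose k)"
proof
  assume "p dvd (m choose k)"
  moreover have "(m choose k) dvd fact m"
    using binomial_fact_lemma[OF assms(3)] by (metis dvd_triv_right)
  ultimately have "p dvd (fact m :: nat)" by (rule dvd_trans)
  then show False using assms by (simp add: prime_dvd_fact_iff)
qed

lemma dvd_both_imp_eq:
  fixes p :: nat
  assumes "p dvd x" "p dvd y" "x < y + p" "y < x + p"
  shows "x = y"
proof (rule ccontr)
  assume "x \<noteq> y"
  then consider "x < y" | "y < x" by linarith
  then show False
  proof cases
    case 1
    then have "p dvd y - x" "0 < y - x" using assms by auto
    then show False using assms dvd_imp_le[of p "y - x"] by simp
  next
    case 2
    then have "p dvd x - y" "0 < x - y" using assms by auto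
    then show False using assms dvd_imp_le[of p "x - y"] by simp
  qed
qed

text \<open>Of the \<open>r\<close> consecutive denominators in the closed form only n + i is a
  multiple of \<open>p > r\<close>, so \<open>p\<close> divides its numerator. There the factor
  \<open>r\<close> and the binomial coefficient are prime to \<open>p\<close>, which leaves 2^(n+i)
  - 1.\<close>

lemma S_sum_Ints_imp_dvd_mersenne:
  assumes S: "S_sum r n \<in> \<int>" and p: "prime p" "r < p" and i: "1 \<le> i" "i \<le> r" and dvd: "p dvd n + i"
  shows "p dvd 2 ^ (n + i) - 1"
proof -
  obtain s where s: "r = Suc s" using i by (cases r) auto
  define a where "a j = (- 1) ^ (s + j) * int r * int (s choose j) * (2 ^ (n + j + 1) - 1)" for j
  have "of_nat r * recip_sum n r \<in> \<int>" using S s by (subst (asm) S_sum_Ints_iff) auto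
  also have "of_nat r * recip_sum n r = (\<Sum>j\<le>s. of_int (a j) / of_nat (n + j + 1))"
    unfolding a_def s recip_sum_closed_form sum_distrib_left by (intro sum.cong) auto
  finally have int: "(\<Sum>j\<le>s. of_int (a j) / of_nat (n + j + 1)) \<in> (\<int> :: rat set)" .
  have "int p dvd a (i - 1)"
  proof (rule prime_dvd_single_numerator[OF _ _ p(1) _ _ _ int])
    show "\<not> p dvd n + j + 1" if "j \<in> {..s}" "j \<noteq> i - 1" for j
    proof
      assume "p dvd n + j + 1"
      then have "n + j + 1 = n + i"
        using dvd i p(2) s that by (intro dvd_both_imp_eq[of p]) auto
      then show False using that by simp
    qed
  qed (use i s dvd in auto)
  then have "int p dvd (- 1) ^ (s + (i - 1)) * (int r * int (s choose (i - 1)) * (2 ^ (n + i) - 1))"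
    using i by (simp add: a_def mult.assoc)
  then have "int p dvd int r * int (s choose (i - 1)) * (2 ^ (n + i) - 1)"
    by (simp only: minus_one_power_iff split: if_splits) simp_all
  moreover have "\<not> p dvd r"
    using p s by (auto dest: dvd_imp_le)
  then have "\<not> int p dvd int r" by (simp only: int_dvd_int_iff not_False_eq_True)
  moreover have "\<not> int p dvd int (s choose (i - 1))"
    using prime_not_dvd_binomial[of p s "i - 1"] p s i by auto
  moreover have "prime (int p)" using p by simp
  ultimately have "int p dvd 2 ^ (n + i) - 1" using prime_dvd_multD by blast
  also have "2 ^ (n + i) - 1 = int (2 ^ (n + i) - 1)" by (simp add: of_nat_diff)
  finally show ?thesis by (simp only: int_dvd_int_iff)
qed

lemma binomial_mult_fact: "(n + r choose r) * fact r = (\<Prod>i=1..r. n + i)"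
proof -
  have "fact (n + r) = fact n * (\<Prod>i=1..r. n + i)"
    by (induction r) (auto simp: algebra_simps)
  moreover have "fact r * fact n * (n + r choose r) = fact (n + r)"
    using binomial_fact_lemma[of r "n + r"] by simp
  ultimately have "fact n * ((n + r choose r) * fact r) = fact n * (\<Prod>i=1..r. n + i)"
    by (simp add: ac_simps)
  then show ?thesis by simp
qed

text \<open>Otherwise \<open>p\<close> divides exactly one of the denominators r+1, ..., r+n of the
  defining sum, but the numerator \<open>i * (n choose i)\<close> above it has no prime factor
  exceeding \<open>n\<close>.\<close>

lemma S_sum_Ints_imp_not_dvd_binomial:
  assumes S: "S_sum r n \<in> \<int>" and p: "prime p" "n < p"
  shows "\<not> p dvd (n + r choose n)"
proof
  assume "p dvd (n + r choose n)"
  then have "p dvd (\<Prod>i=1..n. r + i)"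
    using binomial_mult_fact[of r n] by (metis add.commute dvd_mult2)
  then obtain i where i: "i \<in> {1..n}" "p dvd r + i"
    using p by (subst (asm) prime_dvd_prod_iff) auto
  have "int p dvd int (i * (n choose i))"
  proof (rule prime_dvd_single_numerator[of "{1..n}" i p "\<lambda>k. k + r" "\<lambda>k. int (k * (n choose k))"])
    show "\<not> p dvd k + r" if "k \<in> {1..n}" "k \<noteq> i" for k
    proof
      assume "p dvd k + r"
      then have "k + r = i + r"
        using i p(2) that by (intro dvd_both_imp_eq[of p]) (auto simp: add.commute)
      then show False using that by simp
    qed
    show "(\<Sum>k\<in>{1..n}. of_int (int (k * (n choose k))) / of_nat (k + r)) \<in> (\<int> :: rat set)"
      using S unfolding S_sum_def by simp
  qed (use i p in \<open>auto simp: add.commute\<close>)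
  then have "p dvd i * (n choose i)" by (simp only: int_dvd_int_iff)
  then have "p dvd i \<or> p dvd (n choose i)" using p(1) by (simp add: prime_dvd_mult_iff)
  then show False
    using i p prime_not_dvd_binomial[of p n i] by (auto dest: dvd_imp_le)
qed

subsection \<open>Lucas' theorem\<close>

text \<open>Absorption: \<open>s\<close> times the coefficient has a factor a * p, and
  \<open>s\<close> is prime to \<open>p\<close>.\<close>

lemma prime_dvd_binomial_multiple:
  fixes p :: nat
  assumes "prime p" "\<not> p dvd s"
  shows "p dvd (a * p choose s)"
proof -
  have "s > 0" using assms by (cases s) auto
  then have "s * (a * p choose s) = a * p * ((a * p - 1) choose (s - 1))"
    by (rule times_binomial_minus1_eq)
  then have "p dvd s * (a * p choose s)" by simp
  then show ?thesis using assms by (simp add: prime_dvd_mult_iff)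
qed

lemma cong_sum_single:
  fixes f :: "'i \<Rightarrow> nat"
  assumes "finite A" "i \<in> A" "\<And>j. j \<in> A \<Longrightarrow> j \<noteq> i \<Longrightarrow> p dvd f j"
  shows "[sum f A = f i] (mod p)"
proof -
  have "sum f A = f i + sum f (A - {i})" using assms by (simp add: sum.remove)
  moreover have "p dvd sum f (A - {i})" using assms by (intro dvd_sum) auto
  ultimately show ?thesis by (simp add: cong_def mod_eq_0_iff_dvd mod_add_eq[symmetric, of "f i"])
qed

text \<open>In Vandermonde's identity for p + a * p only the terms with k = 0 and k = p survive
  modulo \<open>p\<close>, and what remains is Pascal's rule for \<open>a choose i\<close>.\<close>

lemma binomial_multiples_cong:
  fixes p :: nat
  assumes "prime p"
  shows "[(a * p choose (i * p)) = (a choose i)] (mod p)"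
proof (induction a arbitrary: i)
  case 0
  then show ?case using prime_gt_0_nat[OF assms] by (cases i) (auto simp: binomial_eq_0)
next
  case (Suc a)
  have p0: "p > 0" using prime_gt_0_nat[OF assms] .
  show ?case
  proof (cases i)
    case (Suc j)
    let ?f = "\<lambda>k. (p choose k) * (a * p choose (i * p - k))"
    have "(Suc a * p choose (i * p)) = (\<Sum>k\<le>i * p. ?f k)"
      using vandermonde[of p "a * p" "i * p"] by simp
    also have "\<dots> = ?f 0 + (\<Sum>k\<in>{1..i * p}. ?f k)"
    proof -
      have "{..i * p} = insert 0 {1..i * p}" by auto
      then show ?thesis by simp
    qed
    finally have e: "(Suc a * p choose (i * p)) = ?f 0 + (\<Sum>k\<in>{1..i * p}. ?f k)" .
    have "[(\<Sum>k\<in>{1..i * p}. ?f k) = ?f p] (mod p)"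
    proof (rule cong_sum_single)
      show "p dvd ?f k" if "k \<in> {1..i * p}" "k \<noteq> p" for k
      proof (cases "k < p")
        case True
        then have "\<not> p dvd k" using that by (auto dest: dvd_imp_le)
        then show ?thesis using prime_dvd_binomial_multiple[OF assms, of k 1] by simp
      next
        case False
        then show ?thesis using that by (simp add: binomial_eq_0)
      qed
    qed (use p0 Suc in auto)
    also have "?f p = (a * p choose (j * p))" using Suc by simp
    also have "[\<dots> = (a choose j)] (mod p)" by (rule Suc.IH)
    finally have "[?f 0 + (\<Sum>k\<in>{1..i * p}. ?f k) = (a choose i) + (a choose j)] (mod p)"
      using Suc.IH[of i] by (intro cong_add) auto
    then show ?thesis unfolding e using Suc by (simp add: add.commute)
  qed simp
qed

text \<open>In Vandermonde's identity for a * p + b only multiples k = j * p survive modulo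
  \<open>p\<close>, and j < i would ask the second factor to choose at least p > b elements out of
  \<open>b\<close>.\<close>

lemma lucas_theorem_step:
  fixes p :: nat
  assumes "prime p" "b < p" "e < p"
  shows "[(a * p + b choose (i * p + e)) = (a choose i) * (b choose e)] (mod p)"
proof -
  let ?f = "\<lambda>k. (a * p choose k) * (b choose (i * p + e - k))"
  have "(a * p + b choose (i * p + e)) = (\<Sum>k\<le>i * p + e. ?f k)"
    by (rule vandermonde[symmetric])
  also have "[(\<Sum>k\<le>i * p + e. ?f k) = ?f (i * p)] (mod p)"
  proof (rule cong_sum_single)
    show "p dvd ?f k" if k: "k \<in> {..i * p + e}" "k \<noteq> i * p" for k
    proof (cases "p dvd k")
      case False
      then show ?thesis using prime_dvd_binomial_multiple[OF assms(1)] by simp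
    next
      case True
      then obtain j where j: "k = j * p" by (metis dvd_def mult.commute)
      have "j * p < Suc i * p" using k j assms by simp
      then have "j < Suc i" by (rule mult_less_cancel2[THEN iffD1, THEN conjunct2])
      with j k have "Suc j \<le> i" by (cases "j = i") auto
      then have "Suc j * p \<le> i * p" by (rule mult_le_mono1)
      then have "b < i * p + e - k" using j assms by simp
      then show ?thesis by (simp add: binomial_eq_0)
    qed
  qed auto
  also have "?f (i * p) = (a * p choose (i * p)) * (b choose e)" by simp
  also have "[\<dots> = (a choose i) * (b choose e)] (mod p)"
    by (intro cong_mult binomial_multiples_cong assms cong_refl)
  finally show ?thesis .
qed

text \<open>Kummer's criterion for two digits. Without a carry in the last digit Lucas factors the
  coefficient, and n + r < p^2 keeps the upper arguments of both factors below
  \<open>p\<close>.\<close>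

lemma prime_dvd_binomial_imp_carry:
  fixes p :: nat
  assumes "prime p" "p dvd (n + r choose n)" "n + r < p * p"
  shows "p \<le> n mod p + r mod p"
proof (rule ccontr)
  assume "\<not> p \<le> n mod p + r mod p"
  then have c: "n mod p + r mod p < p" by simp
  define a b c d where "a = n div p" and "b = n mod p" and "c = r div p" and "d = r mod p"
  have n: "n = a * p + b" and r: "r = c * p + d" by (simp_all add: a_def b_def c_def d_def)
  have "[(n + r choose n) = (a + c choose a) * (b + d choose b)] (mod p)"
  proof -
    have "n + r = (a + c) * p + (b + d)" by (simp add: n r algebra_simps)
    moreover have "b + d < p" using c by (simp add: b_def d_def)
    moreover have "b < p" using c by (simp add: b_def)
    ultimately show ?thesis
      using lucas_theorem_step[OF assms(1), of "b + d" b "a + c" a] n by (simp only:)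
  qed
  then have "p dvd (a + c choose a) * (b + d choose b)"
    using assms(2) cong_dvd_iff by blast
  moreover have "\<not> p dvd (b + d choose b)"
    using c assms(1) by (intro prime_not_dvd_binomial) (auto simp: b_def d_def)
  moreover have "(a + c) * p < p * p"
    using assms(3) n r by (simp add: algebra_simps)
  then have "a + c < p" by simp
  then have "\<not> p dvd (a + c choose a)"
    using assms(1) by (intro prime_not_dvd_binomial) auto
  ultimately show False using assms(1) by (simp add: prime_dvd_mult_iff)
qed

text \<open>Only the terms with \<open>p\<close> dividing k + r matter. By Lucas their binomial
  coefficients share the unit \<open>b choose (p - d)\<close> modulo \<open>p\<close>; without it
  and with denominators cleared there remains a positive integer \<open>W\<close> that depends only
  on the quotients of \<open>n\<close> and \<open>r\<close> by \<open>p\<close>. As \<open>p\<close>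
  divides \<open>W\<close>, it cannot exceed it.\<close>

lemma S_sum_Ints_imp_prime_le:
  assumes S: "S_sum r n \<in> \<int>" and r1: "r \<ge> 1" and p: "prime p" "n + r < p * p"
    and dvd: "p dvd (n + r choose n)"
  shows "p \<le> 2 ^ (n div p) * (n div p + r div p + 1) ^ (n div p + 1)"
proof -
  define a b c d where "a = n div p" and "b = n mod p" and "c = r div p" and "d = r mod p"
  have n: "n = a * p + b" and r: "r = c * p + d" by (simp_all add: a_def b_def c_def d_def)
  have p0: "p > 0" using prime_gt_0_nat[OF p(1)] .
  have carry: "p \<le> b + d"
    using prime_dvd_binomial_imp_carry[OF p(1) dvd p(2)] by (simp add: b_def d_def)
  have bd: "b < p" "d < p" using p0 by (simp_all add: b_def d_def)
  with carry have d0: "d > 0" by simp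
  have pr: "\<not> p dvd r" using d0 by (simp add: d_def dvd_eq_mod_eq_0)
  \<comment> \<open>The solutions k of p | k + r, beginning with p - d. The carry says p - d \<le>
    b, so exactly those with i \<le> a fit below n = a * p + b.\<close>
  define f where "f i = i * p + (p - d)" for i
  define B where "B = {k. k \<le> n \<and> p dvd k + r}"
  have fr: "f i + r = (c + 1 + i) * p" for i
    using bd by (simp add: f_def r algebra_simps)
  have B: "B = f ` {..a}"
  proof
    show "f ` {..a} \<subseteq> B"
    proof clarify
      fix i assume "i \<le> a"
      then have "i * p \<le> a * p" by simp
      then have "f i \<le> n" using carry unfolding f_def n by linarith
      then show "f i \<in> B" by (simp add: B_def fr)
    qed
    show "B \<subseteq> f ` {..a}"
    proof
      fix k assume k: "k \<in> B"
      then obtain q where q: "k + r = q * p" unfolding B_def by (metis (no_types, lifting) dvd_def mem_Collect_eq mult.commute)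
      have "c * p < q * p" using q d0 unfolding r by linarith
      then have "c < q" by simp
      then obtain i where i: "q = c + 1 + i" by (metis Suc_eq_plus1 less_iff_Suc_add add_Suc)
      have fk: "k = f i" using q fr[of i] i by simp
      have "i * p < Suc a * p"
      proof -
        have "i * p + (p - d) \<le> a * p + b" using k fk by (simp add: B_def f_def n)
        then show ?thesis using bd unfolding mult_Suc by linarith
      qed
      then have "i \<le> a" using p0 by (simp only: mult_less_cancel2) simp
      then show "k \<in> f ` {..a}" using fk by simp
    qed
  qed
  have inj: "inj_on f {..a}" using p0 by (auto simp: inj_on_def f_def)
  have "of_nat r * recip_sum n r \<in> \<int>" using S r1 by (simp add: S_sum_Ints_iff)
  then have int: "(\<Sum>k\<le>n. of_int (int (r * (n choose k))) / of_nat (k + r)) \<in> (\<int> :: rat set)"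
    by (simp add: recip_sum_def sum_distrib_left)
  obtain Q where Q: "\<not> p dvd Q"
      "of_nat Q * (\<Sum>k\<in>B. of_int (int (r * (n choose k))) / of_nat (k + r)) \<in> (\<int> :: rat set)"
    by (rule clear_denominators[OF _ _ p(1) _ int, of B]) (auto simp: B_def)
  \<comment> \<open>\<open>J\<close> is a common multiple of the quotients (k + r)/p = c + 1 + i.
    \<open>W'\<close> keeps the true binomial coefficients, while \<open>W\<close> has their
    residues without the common unit.\<close>
  define J where "J = (\<Prod>j\<in>{c + 1..c + 1 + a}. j)"
  define W' where "W' = (\<Sum>i\<le>a. (n choose f i) * (J div (c + 1 + i)))"
  define W where "W = (\<Sum>i\<le>a. (a choose i) * (J div (c + 1 + i)))"
  have J: "c + 1 + i dvd J" if "i \<le> a" for i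
    unfolding J_def using that by (intro dvd_prodI) auto
  obtain z where z: "of_nat Q * (\<Sum>k\<in>B. of_int (int (r * (n choose k))) / of_nat (k + r)) = (of_int z :: rat)"
    using Q(2) by (auto elim: Ints_cases)
  have "(\<Sum>k\<in>B. of_int (int (r * (n choose k))) / of_nat (k + r)) =
      (\<Sum>i\<le>a. of_nat r * of_nat (n choose f i) / (of_nat (c + 1 + i) * of_nat p) :: rat)"
    unfolding B sum.reindex[OF inj]
    by (intro sum.cong) (simp_all only: o_def fr of_nat_mult of_int_mult of_int_of_nat_eq)
  then have "of_nat (p * J) * (of_int z :: rat) =
      of_nat (p * J) * (of_nat Q * (\<Sum>i\<le>a. of_nat r * of_nat (n choose f i) / (of_nat (c + 1 + i) * of_nat p)))"
    using z by simp
  also have "\<dots> = of_nat Q * of_nat r * (\<Sum>i\<le>a. of_nat (n choose f i) * (of_nat J / of_nat (c + 1 + i)))"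
  proof -
    have "of_nat (p * J) * (of_nat Q * (of_nat r * C / (y * of_nat p))) =
        of_nat Q * of_nat r * (C * (of_nat J / y))" if "y \<noteq> 0" for y C :: rat
      using that p0 by (simp add: field_simps)
    then show ?thesis
      unfolding sum_distrib_left by (intro sum.cong refl) (simp del: of_nat_mult of_nat_add)
  qed
  also have "(\<Sum>i\<le>a. of_nat (n choose f i) * (of_nat J / of_nat (c + 1 + i))) = (of_nat W' :: rat)"
  proof -
    have "of_nat J / of_nat y = (of_nat (J div y) :: rat)" if "y dvd J" "y \<noteq> 0" for y
      using that by (auto elim!: dvdE)
    then have "of_nat J / of_nat (c + 1 + i) = (of_nat (J div (c + 1 + i)) :: rat)" if "i \<le> a" for i
      using J[OF that] by (simp del: of_nat_add of_nat_Suc)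
    then show ?thesis unfolding W'_def by (simp del: of_nat_add)
  qed
  finally have "of_int (int (p * J) * z) = (of_int (int (Q * r * W')) :: rat)" by simp
  then have "int (p * J) * z = int (Q * r * W')" by (simp only: of_int_eq_iff)
  moreover have "int p dvd int (p * J) * z" by simp
  ultimately have "p dvd Q * r * W'" by (simp only: int_dvd_int_iff)
  then have pW': "p dvd W'" using Q(1) pr p(1) by (simp add: prime_dvd_mult_iff)
  have "[W' = (\<Sum>i\<le>a. ((a choose i) * (b choose (p - d))) * (J div (c + 1 + i)))] (mod p)"
    unfolding W'_def
  proof (intro cong_sum cong_mult cong_refl)
    fix i
    show "[(n choose f i) = (a choose i) * (b choose (p - d))] (mod p)"
      unfolding f_def n using bd d0 by (intro lucas_theorem_step p(1)) auto
  qed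
  also have "(\<Sum>i\<le>a. ((a choose i) * (b choose (p - d))) * (J div (c + 1 + i))) = (b choose (p - d)) * W"
    unfolding W_def by (simp add: sum_distrib_left ac_simps)
  finally have "p dvd (b choose (p - d)) * W" using pW' cong_dvd_iff by blast
  moreover have "\<not> p dvd (b choose (p - d))"
    using carry bd p(1) by (intro prime_not_dvd_binomial) auto
  ultimately have pW: "p dvd W" using p(1) by (simp add: prime_dvd_mult_iff)
  have J0: "J > 0" unfolding J_def by (intro prod_pos) auto
  \<comment> \<open>The terms of \<open>W\<close> do not alternate, so its first term already makes
    it nonzero, and divisibility by \<open>p\<close> becomes a bound for \<open>p\<close>.\<close>
  have "W \<ge> (a choose 0) * (J div (c + 1 + 0))"
    unfolding W_def by (rule member_le_sum) auto
  moreover have "J div (c + 1) > 0" using J[of 0] J0 by (auto simp: div_greater_zero_iff dest: dvd_imp_le)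
  ultimately have "W > 0" by simp
  then have "p \<le> W" using pW by (rule dvd_imp_le[rotated])
  also have "W \<le> (\<Sum>i\<le>a. (a choose i) * J)"
    unfolding W_def by (intro sum_mono mult_le_mono) auto
  also have "\<dots> = 2 ^ a * J" by (simp add: choose_row_sum sum_distrib_right[symmetric])
  also have "J \<le> (\<Prod>j\<in>{c + 1..c + 1 + a}. a + c + 1)"
    unfolding J_def by (intro prod_mono) auto
  also have "\<dots> = (a + c + 1) ^ (a + 1)" by simp
  finally show ?thesis by (simp add: a_def c_def)
qed

section \<open>Numbers $N$ sharing a large prime factor with $2^N - 1$\<close>

text \<open>The conclusion of \<open>S_sum_Ints_imp_dvd_mersenne\<close> freed from
  \<open>r\<close>, with a fixed threshold \<open>z\<close> for the prime.\<close>

definition special :: "nat \<Rightarrow> nat set" where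
  "special z = {N. N > 0 \<and> (\<exists>p. prime p \<and> z < p \<and> p dvd N \<and> p dvd 2 ^ N - 1)}"

text \<open>By Fermat the order of 2 divides p - 1 and is prime to \<open>p\<close>. Both divide
  \<open>N\<close>, hence so does their product.\<close>

lemma special_imp_mult_ord_dvd:
  assumes "N \<in> special z"
  obtains p where "prime p" "z < p" "ord p 2 > 0" "p dvd 2 ^ ord p 2 - 1" "p * ord p 2 dvd N"
proof -
  obtain p where p: "N > 0" "prime p" "z < p" "p dvd N" "p dvd 2 ^ N - 1"
    using assms by (auto simp: special_def)
  have dvd_iff: "p dvd 2 ^ m - 1 \<longleftrightarrow> [2 ^ m = 1] (mod p)" for m :: nat
    by (simp add: cong_altdef_nat)
  have "\<not> p dvd 2"
  proof
    assume "p dvd 2"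
    then have "p = 2" using p(2) primes_dvd_imp_eq two_is_prime_nat by blast
    then have "even ((2::nat) ^ N - 1)" using p(5) by simp
    then show False using p(1) by (simp add: even_diff_nat)
  qed
  then have cop: "coprime p 2" using p(2) using \<open>\<not> p dvd 2\<close> prime_imp_coprime by blast
  then have pos: "ord p 2 > 0" by simp
  have "ord p 2 dvd p - 1"
    using fermat_theorem[OF p(2) \<open>\<not> p dvd 2\<close>] by (simp only: ord_divides)
  then have "ord p 2 \<le> p - 1"
    using prime_gt_1_nat[OF p(2)] by (intro dvd_imp_le) auto
  then have "ord p 2 < p" using prime_gt_1_nat[OF p(2)] by linarith
  then have "\<not> p dvd ord p 2" using pos by (auto dest: dvd_imp_le)
  then have "coprime p (ord p 2)" using p(2) by (simp add: prime_imp_coprime)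
  moreover have "ord p 2 dvd N" using p(5) by (simp only: dvd_iff ord_divides)
  ultimately have "p * ord p 2 dvd N" using p(4) by (simp add: divides_mult)
  moreover have "p dvd 2 ^ ord p 2 - 1" unfolding dvd_iff by (rule ord)
  ultimately show ?thesis using that p pos by blast
qed

lemma card_multiples_le:
  assumes "d > 0"
  shows "real (card {N \<in> {1..X}. d dvd N}) \<le> real X / real d"
proof -
  have "{N \<in> {1..X}. d dvd N} \<subseteq> (\<lambda>k. d * k) ` {1..X div d}"
  proof
    fix N assume N: "N \<in> {N \<in> {1..X}. d dvd N}"
    then obtain k where k: "N = d * k" by (auto elim: dvdE)
    then have "k \<in> {1..X div d}"
      using N assms by (auto simp: less_eq_div_iff_mult_less_eq mult.commute intro: Suc_leI)
    then show "N \<in> (\<lambda>k. d * k) ` {1..X div d}" using k by blast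
  qed
  then have "card {N \<in> {1..X}. d dvd N} \<le> card ((\<lambda>k. d * k) ` {1..X div d})"
    by (intro card_mono) auto
  also have "\<dots> \<le> X div d" using card_image_le[of "{1..X div d}" "\<lambda>k. d * k"] by simp
  finally have "real (card {N \<in> {1..X}. d dvd N}) \<le> real (X div d)" by simp
  also have "\<dots> \<le> real X / real d" by (rule of_nat_div_le_of_nat)
  finally show ?thesis .
qed

text \<open>The product of these primes divides 2^t - 1 and is at least 2 to their number.\<close>

lemma card_prime_divisors_mersenne_le:
  assumes "t > 0"
  shows "finite {p. prime p \<and> p dvd 2 ^ t - (1::nat)}" "card {p. prime p \<and> p dvd 2 ^ t - (1::nat)} \<le> t"
proof -
  let ?P = "{p. prime p \<and> p dvd 2 ^ t - (1::nat)}"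
  have nz: "2 ^ t - (1::nat) > 0" using assms one_less_power[of "2::nat" t] by simp
  show fin: "finite ?P"
    by (rule finite_subset[of _ "{..2 ^ t - 1}"]) (use nz in \<open>auto dest!: dvd_imp_le\<close>)
  have "2 ^ card ?P = (\<Prod>p\<in>?P. 2::nat)" by simp
  also have "\<dots> \<le> \<Prod>?P" by (intro prod_mono) (auto intro: prime_ge_2_nat)
  also have "\<dots> \<le> 2 ^ t - 1"
    using nz by (intro dvd_imp_le prod_primes_dvd fin) auto
  also have "\<dots> < 2 ^ t" by simp
  finally have "card ?P < t + 1" by (simp add: power_strict_increasing_iff)
  then show "card ?P \<le> t" by simp
qed

lemma sum_inverse_squares_tail:
  assumes "w > 0"
  shows "(\<Sum>t\<in>{w<..w + K}. 1 / real (t * t)) \<le> 1 / real w - 1 / real (w + K)"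
proof (induction K)
  case (Suc K)
  have e: "{w<..w + Suc K} = insert (w + Suc K) {w<..w + K}" by auto
  have "1 / real ((w + Suc K) * (w + Suc K)) \<le> 1 / real (w + K) - 1 / real (w + Suc K)"
  proof -
    define a where "a = real (w + K)"
    have a: "a > 0" "real (w + Suc K) = a + 1" using assms by (auto simp: a_def)
    have "1 / a - 1 / (a + 1) = 1 / (a * (a + 1))" using a by (simp add: field_simps)
    moreover have "1 / ((a + 1) * (a + 1)) \<le> 1 / (a * (a + 1))"
      using a by (intro divide_left_mono mult_right_mono) auto
    ultimately show ?thesis unfolding of_nat_mult a(2) a_def[symmetric] by linarith
  qed
  then show ?case unfolding e using Suc by (subst sum.insert) auto
qed simp

text \<open>The first \<open>w\<close> terms are 1/w^2 each, and the others form a tail of the sum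
  of 1/t^2; either part is at most 1/w.\<close>

lemma sum_inverse_max_squares:
  assumes "w > 0"
  shows "(\<Sum>t\<in>{1..X}. 1 / real (max (w * w) (t * t))) \<le> 2 / real w"
proof -
  let ?f = "\<lambda>t. 1 / real (max (w * w) (t * t))"
  have "sum ?f {1..X} \<le> sum ?f ({1..w} \<union> {w<..w + X})"
    by (rule sum_mono2) auto
  also have "\<dots> = sum ?f {1..w} + sum ?f {w<..w + X}"
    by (rule sum.union_disjoint) auto
  also have "sum ?f {1..w} \<le> (\<Sum>t\<in>{1..w}. 1 / real (w * w))"
  proof (intro sum_mono divide_left_mono of_nat_mono)
    show "0 < real (max (w * w) (t * t)) * real (w * w)" for t
      using assms unfolding of_nat_0_less_iff of_nat_mult[symmetric] by (simp add: less_max_iff_disj)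
  qed auto
  also have "\<dots> = 1 / real w" by simp
  also have "sum ?f {w<..w + X} \<le> (\<Sum>t\<in>{w<..w + X}. 1 / real (t * t))"
  proof (intro sum_mono divide_left_mono of_nat_mono)
    show "0 < real (max (w * w) (t * t)) * real (t * t)" if "t \<in> {w<..w + X}" for t
      using assms that unfolding of_nat_0_less_iff of_nat_mult[symmetric] by (simp add: less_max_iff_disj)
  qed auto
  also have "\<dots> \<le> 1 / real w - 1 / real (w + X)" by (rule sum_inverse_squares_tail[OF assms])
  also have "\<dots> \<le> 1 / real w" by simp
  finally show ?thesis by simp
qed

text \<open>Telescoping: for consecutive square roots a < b one has (b - a)(b + a) = 1, so 2/a - 2/b
  = 2/(ab(a + b)) \<ge> 1/b^3.\<close>

lemma sum_inverse_three_halves_tail: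
  assumes "m > 0"
  shows "(\<Sum>p\<in>{m<..m + K}. 1 / (real p * sqrt (real p))) \<le> 2 / sqrt (real m) - 2 / sqrt (real (m + K))"
proof (induction K)
  case (Suc K)
  have e: "{m<..m + Suc K} = insert (m + Suc K) {m<..m + K}" by auto
  define a where "a = sqrt (real (m + K))"
  define b where "b = sqrt (real (m + Suc K))"
  have a: "a > 0" and b: "b > 0" and ab: "a \<le> b" using assms by (auto simp: a_def b_def)
  have b2: "b * b = real (m + Suc K)" and a2: "a * a = real (m + K)"
    by (auto simp: a_def b_def)
  have "(b - a) * (b + a) = b * b - a * a" by (simp add: algebra_simps)
  then have d: "(b - a) * (b + a) = 1" using a2 b2 by simp
  have "1 / (b * b * b) \<le> 2 / (a * b * (b + a))"
  proof -
    have "a * b * (b + a) \<le> b * b * (b + b)"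
      using a b ab by (intro mult_mono) auto
    then have "a * b * (b + a) \<le> 2 * (b * b * b)" by simp
    moreover have "a * b * (b + a) > 0" "b * b * b > 0" using a b by auto
    moreover have "1 / B \<le> 2 / A" if "A \<le> 2 * B" "A > 0" "B > 0" for A B :: real
      using that by (simp add: field_simps)
    ultimately show ?thesis by blast
  qed
  also have "\<dots> = 2 * ((b - a) * (b + a)) / (a * b * (b + a))" using d by simp
  also have "\<dots> = 2 * (b - a) / (a * b)" using a b by simp
  also have "\<dots> = 2 / a - 2 / b" using a b by (simp add: field_simps)
  finally have "1 / (b * b * b) \<le> 2 / a - 2 / b" .
  then have "1 / (real (m + Suc K) * sqrt (real (m + Suc K))) \<le> 2 / a - 2 / b"
    unfolding b2 by (simp only: b_def)
  then show ?case unfolding e using Suc by (simp add: a_def b_def)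
qed simp

text \<open>With $t$ the order of 2 modulo $p$, the pairs with $p < t^2$ contribute at most the sum of
  $X / p^{3/2}$, and for the others one uses that at most $t$ primes divide $2^t - 1$.\<close>

lemma card_special_le:
  assumes "w > 0"
  shows "real (card (special (w * w) \<inter> {1..X})) \<le> 4 * real X / real w"
proof -
  define M where "M d = {N \<in> {1..X}. d dvd N}" for d
  define I where "I = {p \<in> {w * w<..w * w + X}. prime p \<and> ord p 2 > 0 \<and> p < ord p 2 * ord p 2}"
  define P where "P t = {p. prime p \<and> p dvd 2 ^ t - (1::nat) \<and> w * w < p \<and> t * t \<le> p}" for t
  define U where "U = (\<Union>p\<in>I. M (p * ord p 2))"
  define V where "V = (\<Union>t\<in>{1..X}. \<Union>p\<in>P t. M (p * t))"
  have finP: "finite (P t)" if "t > 0" for t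
    by (rule finite_subset[OF _ card_prime_divisors_mersenne_le(1)[OF that]]) (auto simp: P_def)
  have finU: "finite U" and finV: "finite V"
    unfolding U_def V_def using finP by (auto simp: I_def M_def)
  have "special (w * w) \<inter> {1..X} \<subseteq> U \<union> V"
  proof
    fix N assume N: "N \<in> special (w * w) \<inter> {1..X}"
    then have "N \<in> special (w * w)" by simp
    then obtain p where p: "prime p" "w * w < p" "ord p 2 > 0" "p dvd 2 ^ ord p 2 - 1" "p * ord p 2 dvd N"
      by (rule special_imp_mult_ord_dvd)
    have NM: "N \<in> M (p * ord p 2)" using N p by (auto simp: M_def)
    have "p * ord p 2 \<le> X" using N p(5) by (auto dest!: dvd_imp_le)
    moreover have "p * 1 \<le> p * ord p 2" using p(3) by (intro mult_le_mono2) linarith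
    moreover have "1 * ord p 2 \<le> p * ord p 2"
      using prime_gt_0_nat[OF p(1)] by (intro mult_le_mono1) linarith
    ultimately have "p \<le> X" "ord p 2 \<le> X" by linarith+
    show "N \<in> U \<union> V"
    proof (cases "p < ord p 2 * ord p 2")
      case True
      then have "p \<in> I" using p \<open>p \<le> X\<close> by (auto simp: I_def)
      then show ?thesis using NM by (auto simp: U_def)
    next
      case False
      then have "p \<in> P (ord p 2)" using p by (auto simp: P_def)
      then show ?thesis using NM \<open>ord p 2 \<le> X\<close> p(3)
        unfolding V_def by (intro UnI2 UN_I[of "ord p 2"] UN_I[of p])
          (simp_all only: atLeastAtMost_iff Suc_le_eq One_nat_def)
    qed
  qed
  then have "card (special (w * w) \<inter> {1..X}) \<le> card (U \<union> V)"
    using finU finV by (intro card_mono) auto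
  also have "\<dots> \<le> card U + card V" by (rule card_Un_le)
  finally have "real (card (special (w * w) \<inter> {1..X})) \<le> real (card U) + real (card V)" by simp
  moreover have "real (card U) \<le> 2 * real X / real w"
  proof -
    have "card U \<le> (\<Sum>p\<in>I. card (M (p * ord p 2)))"
      unfolding U_def by (rule card_UN_le) (auto simp: I_def)
    then have "real (card U) \<le> (\<Sum>p\<in>I. real (card (M (p * ord p 2))))"
      by (metis of_nat_le_iff of_nat_sum)
    also have "\<dots> \<le> (\<Sum>p\<in>I. real X * (1 / (real p * sqrt (real p))))"
    proof (rule sum_mono)
      fix p assume p: "p \<in> I"
      then have "p > 0" "ord p 2 > 0" by (auto simp: I_def)
      have "sqrt (real p) \<le> sqrt (real (ord p 2 * ord p 2))"
        using p by (intro real_sqrt_le_mono of_nat_mono) (auto simp: I_def)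
      then have "sqrt (real p) \<le> real (ord p 2)" by simp
      have "real (card (M (p * ord p 2))) \<le> real X / real (p * ord p 2)"
        unfolding M_def using \<open>p > 0\<close> \<open>ord p 2 > 0\<close> by (intro card_multiples_le) auto
      also have "\<dots> \<le> real X / (real p * sqrt (real p))"
        using \<open>p > 0\<close> \<open>sqrt (real p) \<le> real (ord p 2)\<close>
        by (intro divide_left_mono) (auto intro!: mult_left_mono mult_pos_pos)
      finally show "real (card (M (p * ord p 2))) \<le> real X * (1 / (real p * sqrt (real p)))" by simp
    qed
    also have "\<dots> = real X * (\<Sum>p\<in>I. 1 / (real p * sqrt (real p)))"
      by (simp add: sum_distrib_left)
    also have "(\<Sum>p\<in>I. 1 / (real p * sqrt (real p))) \<le> (\<Sum>p\<in>{w * w<..w * w + X}. 1 / (real p * sqrt (real p)))"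
      by (rule sum_mono2) (auto simp: I_def)
    also have "\<dots> \<le> 2 / sqrt (real (w * w)) - 2 / sqrt (real (w * w + X))"
      using assms by (intro sum_inverse_three_halves_tail) simp
    also have "\<dots> \<le> 2 / real w" by simp
    finally have "real (card U) \<le> real X * (2 / real w)" by (simp add: mult_left_mono)
    then show ?thesis by (simp add: mult.commute)
  qed
  moreover have "real (card V) \<le> 2 * real X / real w"
  proof -
    have "card V \<le> (\<Sum>t\<in>{1..X}. card (\<Union>p\<in>P t. M (p * t)))"
      unfolding V_def by (rule card_UN_le) auto
    also have "\<dots> \<le> (\<Sum>t\<in>{1..X}. \<Sum>p\<in>P t. card (M (p * t)))"
      using finP by (intro sum_mono card_UN_le) auto
    finally have "real (card V) \<le> real (\<Sum>t\<in>{1..X}. \<Sum>p\<in>P t. card (M (p * t)))"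
      by (rule of_nat_mono)
    also have "\<dots> = (\<Sum>t\<in>{1..X}. \<Sum>p\<in>P t. real (card (M (p * t))))"
      by (simp only: of_nat_sum)
    also have "\<dots> \<le> (\<Sum>t\<in>{1..X}. real X * (1 / real (max (w * w) (t * t))))"
    proof (rule sum_mono)
      fix t assume "t \<in> {1..X}"
      then have t: "t > 0" by simp
      \<comment> \<open>A lower bound for all primes in \<open>P t\<close>. For small
        \<open>t\<close> it is w * w that keeps the sum over \<open>t\<close> of order 1/w.\<close>
      define m where "m = max (w * w) (t * t)"
      have m: "m > 0" using t by (simp add: m_def less_max_iff_disj)
      have "(\<Sum>p\<in>P t. real (card (M (p * t)))) \<le> (\<Sum>p\<in>P t. real X / real (m * t))"
      proof (rule sum_mono)
        fix p assume p: "p \<in> P t"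
        then have pm: "m \<le> p" by (auto simp: P_def m_def)
        have "real (card (M (p * t))) \<le> real X / real (p * t)"
          unfolding M_def using t m pm by (intro card_multiples_le) auto
        also have "\<dots> \<le> real X / real (m * t)"
          using t m pm by (intro divide_left_mono of_nat_mono mult_le_mono1) (auto intro!: mult_pos_pos)
        finally show "real (card (M (p * t))) \<le> real X / real (m * t)" .
      qed
      also have "\<dots> = real (card (P t)) * (real X / real (m * t))" by simp
      also have "\<dots> \<le> real t * (real X / real (m * t))"
      proof (intro mult_right_mono of_nat_mono)
        have "card (P t) \<le> card {p. prime p \<and> p dvd 2 ^ t - (1::nat)}"
          by (rule card_mono[OF card_prime_divisors_mersenne_le(1)[OF t]]) (auto simp: P_def)
        also have "\<dots> \<le> t" by (rule card_prime_divisors_mersenne_le(2)[OF t])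
        finally show "card (P t) \<le> t" .
      qed simp
      also have "\<dots> = real X * (1 / real m)" using t m by (simp add: field_simps)
      finally show "(\<Sum>p\<in>P t. real (card (M (p * t)))) \<le> real X * (1 / real (max (w * w) (t * t)))"
        by (simp only: m_def)
    qed
    also have "\<dots> = real X * (\<Sum>t\<in>{1..X}. 1 / real (max (w * w) (t * t)))"
      by (simp only: sum_distrib_left)
    also have "\<dots> \<le> real X * (2 / real w)"
      by (intro mult_left_mono sum_inverse_max_squares assms) simp
    finally show ?thesis by (simp add: mult.commute)
  qed
  ultimately show ?thesis by (simp add: add_divide_distrib[symmetric])
qed

section \<open>Smooth numbers\<close>

text \<open>A truncated Euler product. Numbers divisible by the new prime are \<open>p\<close> times
  numbers of the same set, so the new sum is at most the old one plus t < 1 times itself. Solving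
  for it replaces the geometric series.\<close>

lemma sum_smooth_powr_le:
  fixes \<sigma> :: real
  assumes "finite P" "\<And>p. p \<in> P \<Longrightarrow> prime p" "\<sigma> > 0"
  shows "(\<Sum>N | N \<in> {1..X} \<and> prime_factors N \<subseteq> P. real N powr - \<sigma>) \<le>
    (\<Prod>p\<in>P. 1 / (1 - real p powr - \<sigma>))"
  using assms(1,2)
proof (induction P rule: finite_induct)
  case empty
  have "{N \<in> {1..X}. prime_factors N \<subseteq> {}} \<subseteq> {1}"
    by (auto simp: prime_factorization_empty_iff)
  then have "(\<Sum>N\<in>{N \<in> {1..X}. prime_factors N \<subseteq> {}}. real N powr - \<sigma>) \<le> (\<Sum>N\<in>{1}. real N powr - \<sigma>)"
    by (intro sum_mono2) auto
  then show ?case by simp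
next
  case (insert p P)
  let ?S = "\<lambda>P. {N. N \<in> {1..X} \<and> prime_factors N \<subseteq> P}"
  let ?f = "\<lambda>N. real N powr - \<sigma>"
  have p: "prime p" using insert by simp
  have p1: "p > 1" using prime_gt_1_nat[OF p] .
  define t where "t = real p powr - \<sigma>"
  have t1: "t < 1" unfolding t_def using p1 assms(3) by (simp add: powr_less_one)
  have "?S (insert p P) \<subseteq> ?S P \<union> (\<lambda>N. p * N) ` ?S (insert p P)"
  proof
    fix N assume N: "N \<in> ?S (insert p P)"
    show "N \<in> ?S P \<union> (\<lambda>N. p * N) ` ?S (insert p P)"
    proof (cases "p dvd N")
      case False
      then have "p \<notin> prime_factors N" by auto
      then show ?thesis using N by auto
    next
      case True
      then obtain k where k: "N = p * k" by (auto elim: dvdE)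
      have k0: "k > 0" using N k by (cases k) auto
      have "k \<le> N" using k p1 by simp
      moreover have "prime_factors k \<subseteq> prime_factors N"
        using N k by (intro dvd_prime_factors) auto
      ultimately have "k \<in> ?S (insert p P)" using N k0 by auto
      then show ?thesis using k by blast
    qed
  qed
  then have "sum ?f (?S (insert p P)) \<le> sum ?f (?S P \<union> (\<lambda>N. p * N) ` ?S (insert p P))"
    by (intro sum_mono2) auto
  also have "\<dots> \<le> sum ?f (?S P) + sum ?f ((\<lambda>N. p * N) ` ?S (insert p P))"
    by (subst sum.union_inter[symmetric]) (auto intro!: sum_nonneg)
  also have "sum ?f ((\<lambda>N. p * N) ` ?S (insert p P)) = (\<Sum>N\<in>?S (insert p P). ?f (p * N))"
    using p1 by (subst sum.reindex) (auto simp: inj_on_def)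
  also have "\<dots> = t * sum ?f (?S (insert p P))"
    by (simp add: powr_mult sum_distrib_left t_def)
  finally have "(1 - t) * sum ?f (?S (insert p P)) \<le> sum ?f (?S P)"
    by (simp add: algebra_simps)
  also have "\<dots> \<le> (\<Prod>p\<in>P. 1 / (1 - real p powr - \<sigma>))"
    using insert by simp
  finally have "sum ?f (?S (insert p P)) \<le> (\<Prod>p\<in>P. 1 / (1 - real p powr - \<sigma>)) / (1 - t)"
    using t1 by (simp add: field_simps)
  then show ?case using insert by (simp add: t_def)
qed

text \<open>Rankin's method: every counted N has 1 \<le> (X/N)^\<sigma> with \<sigma> = 1 -
  \<epsilon>. In the exponent of the Euler product p^(-\<sigma>) is at most z^\<epsilon> / p, and
  the sum over primes is extended to the harmonic sum, which is crude but costs only a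
  logarithm.\<close>

lemma card_smooth_le:
  fixes \<epsilon> :: real
  assumes "0 < \<epsilon>" "\<epsilon> \<le> 1 / 4" "z \<ge> 1" "X \<ge> 1"
  shows "real (card {N \<in> {1..X}. prime_factors N \<subseteq> {p. prime p \<and> p \<le> z}}) \<le>
    real X powr (1 - \<epsilon>) * exp (3 * real z powr \<epsilon> * (1 + ln (real z)))"
proof -
  define \<sigma> where "\<sigma> = 1 - \<epsilon>"
  have \<sigma>: "\<sigma> \<ge> 3/4" "\<sigma> > 0" using assms by (auto simp: \<sigma>_def)
  let ?P = "{p. prime p \<and> p \<le> z}"
  let ?S = "{N. N \<in> {1..X} \<and> prime_factors N \<subseteq> ?P}"
  have "real (card ?S) = (\<Sum>N\<in>?S. 1)" by simp
  also have "\<dots> \<le> (\<Sum>N\<in>?S. real X powr \<sigma> * real N powr - \<sigma>)"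
  proof (rule sum_mono)
    fix N assume N: "N \<in> ?S"
    have "real N powr \<sigma> \<le> real X powr \<sigma>" using N \<sigma> by (intro powr_mono2) auto
    then show "1 \<le> real X powr \<sigma> * real N powr - \<sigma>"
      using N by (simp add: powr_minus field_simps)
  qed
  also have "\<dots> = real X powr \<sigma> * (\<Sum>N\<in>?S. real N powr - \<sigma>)" by (simp only: sum_distrib_left)
  also have "\<dots> \<le> real X powr \<sigma> * (\<Prod>p\<in>?P. 1 / (1 - real p powr - \<sigma>))"
    using \<sigma> by (intro mult_left_mono sum_smooth_powr_le) auto
  also have "(\<Prod>p\<in>?P. 1 / (1 - real p powr - \<sigma>)) \<le> (\<Prod>p\<in>?P. exp (3 * real p powr - \<sigma>))"
  proof (rule prod_mono)
    fix p assume p: "p \<in> ?P"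
    define t where "t = real p powr - \<sigma>"
    \<comment> \<open>As \<sigma> \<ge> 3/4, even p = 2 gives t \<le> 2/3, hence 1/(1 - t) \<le> 1 +
      3t.\<close>
    have "(3/2 :: real) \<le> 2 powr (3/4)"
    proof -
      have "(3/2 :: real) powr 4 \<le> 8" by (simp add: power4_eq_xxxx)
      then have "((3/2 :: real) powr 4) powr (1/4) \<le> 8 powr (1/4)" by (intro powr_mono2) auto
      also have "(8::real) powr (1/4) = (2 powr 3) powr (1/4)" by simp
      finally show ?thesis by (simp only: powr_powr) simp
    qed
    also have "\<dots> \<le> 2 powr \<sigma>" using \<sigma> by (intro powr_mono) auto
    also have "\<dots> \<le> real p powr \<sigma>"
      using p \<sigma> prime_ge_2_nat[of p] by (intro powr_mono2) auto
    finally have t: "t \<le> 2/3" "t > 0"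
      using p prime_gt_0_nat[of p] by (auto simp: t_def powr_minus field_simps)
    have "1 / (1 - t) = 1 + t / (1 - t)" using t by (simp add: field_simps)
    also have "\<dots> \<le> 1 + 3 * t"
      using t mult_right_mono[of "1/3" "1 - t" "3 * t"] by (simp add: field_simps)
    also have "\<dots> \<le> exp (3 * t)" by (rule exp_ge_add_one_self)
    finally show "0 \<le> 1 / (1 - real p powr - \<sigma>) \<and> 1 / (1 - real p powr - \<sigma>) \<le> exp (3 * real p powr - \<sigma>)"
      using t by (simp add: t_def)
  qed
  also have "\<dots> = exp (\<Sum>p\<in>?P. 3 * real p powr - \<sigma>)" by (simp add: exp_sum)
  also have "(\<Sum>p\<in>?P. 3 * real p powr - \<sigma>) \<le> (\<Sum>p\<in>{1..z}. 3 * real p powr - \<sigma>)"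
    by (rule sum_mono2) (auto dest: prime_ge_1_nat)
  also have "\<dots> \<le> (\<Sum>p\<in>{1..z}. 3 * real z powr \<epsilon> * inverse (real p))"
  proof (rule sum_mono)
    fix p assume p: "p \<in> {1..z}"
    have "real p powr - \<sigma> = real p powr \<epsilon> * inverse (real p)"
      using p by (simp add: \<sigma>_def powr_diff powr_minus divide_simps)
    also have "\<dots> \<le> real z powr \<epsilon> * inverse (real p)"
      using p assms by (intro mult_right_mono powr_mono2) auto
    finally show "3 * real p powr - \<sigma> \<le> 3 * real z powr \<epsilon> * inverse (real p)" by simp
  qed
  also have "\<dots> = 3 * real z powr \<epsilon> * harm z"
    by (simp only: sum_distrib_left harm_def)
  also have "\<dots> \<le> 3 * real z powr \<epsilon> * (1 + ln (real z))"
    using euler_mascheroni_sequence_decreasing[of 1 z] assms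
    by (intro mult_left_mono) (auto simp: harm_def)
  finally show ?thesis by (simp add: \<sigma>_def mult_left_mono)
qed

section \<open>A covering argument\<close>

text \<open>Going upwards from $m$, an element $n$ of $B$ lets one skip the $r$ numbers from $n$ on, and the
  intervals $(n, n + r]$ met in this way are disjoint.\<close>

lemma card_covering_le:
  fixes g :: real and B T :: "nat set"
  assumes g: "g \<ge> 0"
    and B: "\<And>n. n \<in> B \<Longrightarrow> n \<le> X \<Longrightarrow>
      \<exists>r\<ge>1. n + r \<le> Y \<and> real r * g \<le> real (card (T \<inter> {n<..n + r}))"
  shows "real (card (B \<inter> {m..X})) * g \<le> real (card (T \<inter> {m<..Y}))"
proof (induction "Suc X - m" arbitrary: m rule: less_induct)
  case less
  consider "m > X" | "m \<le> X" "m \<notin> B" | "m \<le> X" "m \<in> B" by linarith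
  then show ?case
  proof cases
    case 1
    then show ?thesis by simp
  next
    case 2
    then have "B \<inter> {m..X} = B \<inter> {Suc m..X}" by (auto simp: Suc_le_eq le_less)
    moreover have "real (card (B \<inter> {Suc m..X})) * g \<le> real (card (T \<inter> {Suc m<..Y}))"
      using 2 by (intro less) auto
    moreover have "card (T \<inter> {Suc m<..Y}) \<le> card (T \<inter> {m<..Y})"
      by (intro card_mono) auto
    ultimately show ?thesis by simp
  next
    case 3
    then obtain r where r: "r \<ge> 1" "m + r \<le> Y" "real r * g \<le> real (card (T \<inter> {m<..m + r}))"
      using B by blast
    have "B \<inter> {m..X} \<subseteq> {m..<m + r} \<union> (B \<inter> {m + r..X})" by auto
    then have "card (B \<inter> {m..X}) \<le> card ({m..<m + r} \<union> (B \<inter> {m + r..X}))"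
      by (intro card_mono) auto
    also have "\<dots> \<le> r + card (B \<inter> {m + r..X})"
      using card_Un_le[of "{m..<m + r}" "B \<inter> {m + r..X}"] by simp
    finally have "real (card (B \<inter> {m..X})) \<le> real r + real (card (B \<inter> {m + r..X}))" by simp
    then have "real (card (B \<inter> {m..X})) * g \<le> (real r + real (card (B \<inter> {m + r..X}))) * g"
      using g by (rule mult_right_mono)
    also have "\<dots> = real r * g + real (card (B \<inter> {m + r..X})) * g" by (rule distrib_right)
    also have "\<dots> \<le> real (card (T \<inter> {m<..m + r})) + real (card (T \<inter> {m + r<..Y}))"
      using 3 r by (intro add_mono less) auto
    also have "\<dots> = real (card ((T \<inter> {m<..m + r}) \<union> (T \<inter> {m + r<..Y})))"
      by (subst card_Un_disjoint) auto
    also have "(T \<inter> {m<..m + r}) \<union> (T \<inter> {m + r<..Y}) = T \<inter> {m<..Y}"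
      using r by auto
    finally show ?thesis .
  qed
qed

section \<open>The possible size of the shift\<close>

text \<open>Primes up to \<open>r\<close> cost a factor n + r each. Several larger primes may divide
  the same n + i, so these are not counted one by one: their joint part \<open>Y\<close> divides the
  product of the n + i with \<open>i\<close> in \<open>I\<close>.\<close>

lemma binomial_le_power_rough:
  assumes "r \<ge> 1"
  shows "(n + r choose r) \<le>
    (n + r) ^ (prime_count r + card {i \<in> {1..r}. \<exists>p. prime p \<and> r < p \<and> p dvd n + i})"
proof -
  define C where "C = (n + r choose r)"
  define I where "I = {i \<in> {1..r}. \<exists>p. prime p \<and> r < p \<and> p dvd n + i}"
  define F where "F = prime_factors C"
  define X where "X = (\<Prod>p\<in>{p \<in> F. p \<le> r}. p ^ multiplicity p C)"
  define Y where "Y = (\<Prod>p\<in>{p \<in> F. r < p}. p ^ multiplicity p C)"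
  have C0: "C \<noteq> 0" by (simp add: C_def)
  have finF: "finite F" and primeF: "p \<in> F \<Longrightarrow> prime p" for p by (auto simp: F_def)
  have CXY: "C = X * Y"
  proof -
    have "C = (\<Prod>p\<in>F. p ^ multiplicity p C)"
      using C0 by (simp add: F_def prime_factorization_nat)
    also have "F = {p \<in> F. p \<le> r} \<union> {p \<in> F. r < p}" by auto
    also have "(\<Prod>p\<in>\<dots>. p ^ multiplicity p C) = X * Y"
      unfolding X_def Y_def using finF by (intro prod.union_disjoint) auto
    finally show ?thesis .
  qed
  have "X \<le> (n + r) ^ card {p. prime p \<and> p \<le> r}"
  proof (rule divisor_binomial_le)
    show "X dvd (n + r choose r)" using CXY by (metis C_def dvd_triv_left)
    show "prime_factors X \<subseteq> {p. prime p \<and> p \<le> r}"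
    proof
      fix q assume q: "q \<in> prime_factors X"
      then have "prime q" "q dvd X" by auto
      then obtain p where p: "p \<in> F" "p \<le> r" "q dvd p ^ multiplicity p C"
        using finF unfolding X_def by (subst (asm) prime_dvd_prod_iff) auto
      then have "q dvd p" using \<open>prime q\<close> prime_dvd_power by blast
      then have "q = p" using \<open>prime q\<close> primeF[OF p(1)] primes_dvd_imp_eq by blast
      then show "q \<in> {p. prime p \<and> p \<le> r}" using p \<open>prime q\<close> by simp
    qed
  qed (use assms in auto)
  moreover have "Y \<le> (n + r) ^ card I"
  proof -
    have "(\<Prod>i=1..r. n + i) = (\<Prod>i\<in>I \<union> ({1..r} - I). n + i)"
      by (intro prod.cong) (auto simp: I_def)
    also have "\<dots> = (\<Prod>i\<in>I. n + i) * (\<Prod>i\<in>{1..r}-I. n + i)"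
      by (rule prod.union_disjoint) (auto simp: I_def)
    finally have split: "(\<Prod>i=1..r. n + i) = (\<Prod>i\<in>I. n + i) * (\<Prod>i\<in>{1..r}-I. n + i)" .
    have "Y dvd C" using CXY by simp
    then have "Y dvd (\<Prod>i=1..r. n + i)"
      using binomial_mult_fact[of n r] by (metis C_def dvd_mult2)
    moreover have "coprime Y (\<Prod>i\<in>{1..r}-I. n + i)"
      unfolding Y_def
    proof (intro prod_coprime_left prod_coprime_right)
      fix i p assume p: "p \<in> {p \<in> F. r < p}" and i: "i \<in> {1..r} - I"
      then have "\<not> p dvd n + i" using primeF by (auto simp: I_def)
      then show "coprime (p ^ multiplicity p C) (n + i)"
        using p primeF by (simp add: prime_imp_coprime)
    qed
    ultimately have "Y dvd (\<Prod>i\<in>I. n + i)"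
      unfolding split by (simp add: coprime_dvd_mult_left_iff)
    then have "Y \<le> (\<Prod>i\<in>I. n + i)"
      by (rule dvd_imp_le) (auto simp: I_def intro: prod_pos)
    also have "\<dots> \<le> (\<Prod>i\<in>I. n + r)" by (intro prod_mono) (auto simp: I_def)
    finally show ?thesis by simp
  qed
  ultimately have "X * Y \<le> (n + r) ^ card {p. prime p \<and> p \<le> r} * (n + r) ^ card I"
    by (rule mult_le_mono)
  then show ?thesis
    unfolding C_def[symmetric] I_def[symmetric] prime_count_def by (simp add: CXY power_add)
qed

text \<open>Clearing the denominator gives u (v - 5) \<le> v^2 + v, and this is at most (v + 12)(v -
  5) exactly when v \<ge> 10. The 5 is Chebyshev's constant, and the summand 1 leaves room for the
  special numbers. This is the origin of \<open>exp 12\<close>.\<close>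

lemma log_gap:
  fixes u v :: real
  assumes "v \<ge> 10" "u - v \<le> 5 * u / v + 1"
  shows "u \<le> v + 12"
proof -
  have "(u - v) * v \<le> (5 * u / v + 1) * v" using assms by (intro mult_right_mono) auto
  also have "\<dots> = 5 * u + v" using assms(1) by (simp add: field_simps)
  finally have "u * (v - 5) \<le> v * v + v" by (simp add: algebra_simps)
  also have "\<dots> \<le> (v + 12) * (v - 5)" using assms(1) by (simp add: algebra_simps)
  finally show ?thesis using assms(1) by (simp add: mult_le_cancel_right)
qed

lemma ln_binomial_ge:
  assumes "0 < k" "k \<le> m"
  shows "real k * (ln (real m) - ln (real k)) \<le> ln (real (m choose k))"
proof -
  have "real k * (ln (real m) - ln (real k)) = ln ((real m / real k) ^ k)"
    using assms by (simp add: ln_realpow ln_div)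
  also have "\<dots> \<le> ln (real (m choose k))"
    using assms binomial_ge_n_over_k_pow_k[of k m, where 'a = real]
    by (subst ln_le_cancel_iff) auto
  finally show ?thesis .
qed

text \<open>Only primes up to \<open>n\<close> divide the coefficient, so ((n+r)/n)^n is at most
  (n+r) to the number of these primes, and \<open>log_gap\<close> applies. The result is only the
  starting point for a stronger bound: it keeps n + r linear in \<open>n\<close>.\<close>

lemma S_sum_Ints_imp_shift_le:
  assumes S: "S_sum r n \<in> \<int>" and r: "r \<ge> 1" and n: "ln (real n) \<ge> 10"
  shows "real (n + r) \<le> exp 12 * real n"
proof -
  have n2: "n \<ge> 2" using n by (cases "n \<le> 1") (auto simp: le_Suc_eq)
  define u v where "u = ln (real (n + r))" and "v = ln (real n)"
  have u0: "u > 0" using n2 by (simp add: u_def)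
  have "(n + r choose n) \<le> (n + r) ^ card {p. prime p \<and> p \<le> n}"
  proof (rule divisor_binomial_le[of _ _ n])
    show "prime_factors (n + r choose n) \<subseteq> {p. prime p \<and> p \<le> n}"
      using S_sum_Ints_imp_not_dvd_binomial[OF S] by (auto simp: in_prime_factors_iff not_less[symmetric])
  qed (use n2 in auto)
  then have "real (n + r choose n) \<le> real ((n + r) ^ prime_count n)"
    unfolding prime_count_def by (rule of_nat_mono)
  then have "ln (real (n + r choose n)) \<le> ln (real ((n + r) ^ prime_count n))"
    using n2 by (subst ln_le_cancel_iff) auto
  also have "\<dots> = real (prime_count n) * u"
    using n2 by (simp add: ln_realpow u_def)
  also have "\<dots> \<le> 5 * real n / v * u"
    unfolding v_def using u0 n2 by (intro mult_right_mono prime_count_le) auto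
  finally have "real n * (u - v) \<le> 5 * real n / v * u"
    using ln_binomial_ge[of n "n + r"] n2 by (simp add: u_def v_def)
  also have "\<dots> = real n * (5 * u / v)" by simp
  finally have "u - v \<le> 5 * u / v" using n2 by (subst (asm) mult_le_cancel_left_pos) auto
  then have "u \<le> v + 12" using n by (intro log_gap) (auto simp: v_def)
  then have "exp u \<le> exp (v + 12)" by simp
  then show ?thesis using n2 by (simp add: u_def v_def exp_add mult.commute)
qed

text \<open>The same comparison with the roles of \<open>n\<close> and \<open>r\<close> exchanged.
  Each \<open>i\<close> in \<open>I\<close> makes n + i special, so with too few special numbers
  \<open>log_gap\<close> would give n + r \<le> e^12 r, against the assumption on
  \<open>n\<close>.\<close>

lemma S_sum_Ints_imp_many_special:
  assumes S: "S_sum r n \<in> \<int>" and r: "r \<ge> 1" "z \<le> r" "ln (real r) \<ge> 10"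
    and n: "exp 12 * real r \<le> real n"
  shows "real r \<le> real (card (special z \<inter> {n<..n + r})) * ln (real (n + r))"
proof (rule ccontr)
  assume neg: "\<not> ?thesis"
  define I where "I = {i \<in> {1..r}. \<exists>p. prime p \<and> r < p \<and> p dvd n + i}"
  define u v where "u = ln (real (n + r))" and "v = ln (real r)"
  have r2: "r \<ge> 2" using r(3) by (cases "r \<le> 1") (auto simp: le_Suc_eq)
  have u0: "u > 0" using r2 by (simp add: u_def)
  have "(\<lambda>i. n + i) ` I \<subseteq> special z \<inter> {n<..n + r}"
  proof
    fix N assume "N \<in> (\<lambda>i. n + i) ` I"
    then obtain i p where i: "N = n + i" "i \<in> {1..r}" "prime p" "r < p" "p dvd n + i"
      by (auto simp: I_def)
    then have "p dvd 2 ^ (n + i) - 1" using S by (intro S_sum_Ints_imp_dvd_mersenne) auto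
    then show "N \<in> special z \<inter> {n<..n + r}" using i r(2) by (auto simp: special_def)
  qed
  then have "card ((\<lambda>i. n + i) ` I) \<le> card (special z \<inter> {n<..n + r})"
    by (intro card_mono) auto
  then have "card I \<le> card (special z \<inter> {n<..n + r})" by (simp add: card_image)
  then have "real (card I) * u \<le> real (card (special z \<inter> {n<..n + r})) * u"
    using u0 by (intro mult_right_mono) auto
  also have "\<dots> < real r" using neg by (simp add: u_def)
  finally have I: "real (card I) * u < real r" .
  have "real (n + r choose r) \<le> real ((n + r) ^ (prime_count r + card I))"
    unfolding I_def using r by (intro of_nat_mono binomial_le_power_rough) auto
  then have "ln (real (n + r choose r)) \<le> ln (real ((n + r) ^ (prime_count r + card I)))"
    using r2 by (subst ln_le_cancel_iff) auto
  also have "\<dots> = real (prime_count r) * u + real (card I) * u"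
    using r2 by (simp add: ln_realpow u_def algebra_simps)
  also have "real (prime_count r) * u \<le> 5 * real r / v * u"
    unfolding v_def using u0 r2 by (intro mult_right_mono prime_count_le) auto
  finally have "real r * (u - v) < 5 * real r / v * u + real r"
    using I ln_binomial_ge[of r "n + r"] r2 by (simp add: u_def v_def)
  also have "\<dots> = real r * (5 * u / v + 1)" by (simp add: algebra_simps)
  finally have "u - v < 5 * u / v + 1" using r2 by (subst (asm) mult_less_cancel_left_pos) auto
  then have "u \<le> v + 12" using r by (intro log_gap) (auto simp: v_def)
  then have "exp u \<le> exp (v + 12)" by simp
  then have "real (n + r) \<le> exp 12 * real r" using r2 by (simp add: u_def v_def exp_add mult.commute)
  then show False using n r2 by simp
qed

lemma S_sum_Ints_imp_shift_small:
  obtains N0 where "\<And>n r. n \<ge> N0 \<Longrightarrow> r \<ge> 1 \<Longrightarrow> S_sum r n \<in> \<int> \<Longrightarrow> exp 12 * real r < real n"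
proof -
  define E :: real where "E = exp 12"
  have E: "E > 0" by (simp add: E_def)
  define h where "h = ln (1 + 1 / E)"
  have h: "h > 0" unfolding h_def using E by (intro ln_gt_zero) simp
  \<comment> \<open>If n \<le> E r, the coefficient has logarithm at least h n. Primes up to q \<le>
    \<eta> n provide at most (5q / ln q) * 2 ln q \<le> 10 \<eta> n, which is half of that.\<close>
  define \<eta> where "\<eta> = h / 20"
  have \<eta>: "\<eta> > 0" using h by (simp add: \<eta>_def)
  \<comment> \<open>For p > \<eta> n, \<open>m\<close> bounds n div p + r div p + 1, and
    \<open>H\<close> is the resulting bound for \<open>p\<close>; when H \<le> \<eta> n no such
    prime is left.\<close>
  define m where "m = nat \<lceil>(1 + E) / \<eta>\<rceil> + 1"
  define H where "H = 2 ^ m * m ^ (m + 1)"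
  \<comment> \<open>The subtracted 1 pays for rounding \<eta> n down to \<open>q\<close>. The square
    condition yields q^2 \<ge> n + r, so that every prime above \<open>q\<close> satisfies n + r <
    p^2.\<close>
  have "eventually (\<lambda>t::real. 2 \<le> \<eta> * t - 1 \<and> (1 + E) * t \<le> (\<eta> * t - 1)\<^sup>2 \<and> real H \<le> \<eta> * t \<and> 10 \<le> ln t \<and> 1 \<le> t) at_top"
  proof (intro eventually_conj)
    show "eventually (\<lambda>t. 2 \<le> \<eta> * t - 1) at_top" using \<eta> by real_asymp
    show "eventually (\<lambda>t. (1 + E) * t \<le> (\<eta> * t - 1)\<^sup>2) at_top" using \<eta> E by real_asymp
    show "eventually (\<lambda>t. real H \<le> \<eta> * t) at_top" using \<eta> by real_asymp
    show "eventually (\<lambda>t::real. 10 \<le> ln t) at_top" by real_asymp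
    show "eventually (\<lambda>t::real. 1 \<le> t) at_top" by real_asymp
  qed
  then have "eventually (\<lambda>n. 2 \<le> \<eta> * real n - 1 \<and> (1 + E) * real n \<le> (\<eta> * real n - 1)\<^sup>2 \<and>
      real H \<le> \<eta> * real n \<and> 10 \<le> ln (real n) \<and> 1 \<le> real n) sequentially"
    using filterlim_real_sequentially by (rule eventually_compose_filterlim)
  then obtain N0 where N0: "\<And>n. n \<ge> N0 \<Longrightarrow> 2 \<le> \<eta> * real n - 1 \<and> (1 + E) * real n \<le> (\<eta> * real n - 1)\<^sup>2 \<and>
      real H \<le> \<eta> * real n \<and> 10 \<le> ln (real n) \<and> 1 \<le> real n"
    by (auto simp: eventually_sequentially)
  show ?thesis
  proof (rule that[of N0], rule ccontr)
    fix n r assume n: "n \<ge> N0" and r: "r \<ge> 1" and S: "S_sum r n \<in> \<int>"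
    assume "\<not> exp 12 * real r < real n"
    then have nr: "real n \<le> E * real r" by (simp add: E_def)
    have c: "2 \<le> \<eta> * real n - 1" "(1 + E) * real n \<le> (\<eta> * real n - 1)\<^sup>2"
        "real H \<le> \<eta> * real n" "10 \<le> ln (real n)" "1 \<le> real n"
      using N0[OF n] by blast+
    have "real (n + r) \<le> E * real n"
      unfolding E_def using S r c(4) by (rule S_sum_Ints_imp_shift_le)
    then have up: "real (n + r) \<le> (1 + E) * real n" using c(5) by (simp add: algebra_simps)
    define q where "q = nat \<lfloor>\<eta> * real n\<rfloor>"
    have q: "\<eta> * real n - 1 \<le> real q" "real q \<le> \<eta> * real n"
      using c(1) unfolding q_def by linarith+
    have q2: "q \<ge> 2" using q(1) c(1) by linarith
    have "(\<eta> * real n - 1)\<^sup>2 \<le> (real q)\<^sup>2" using q(1) c(1) by (intro power_mono) auto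
    then have nrq: "real (n + r) \<le> (real q)\<^sup>2" using up c(2) by linarith
    have "p \<le> q" if p: "prime p" "p dvd (n + r choose n)" for p
    proof (rule ccontr)
      assume "\<not> p \<le> q"
      then have pq: "q < p" by simp
      then have pn: "\<eta> * real n < real p" unfolding q_def by linarith
      have "(real q)\<^sup>2 < (real p)\<^sup>2" using pq by (intro power_strict_mono) auto
      then have "real (n + r) < real (p * p)" using nrq by (simp add: power2_eq_square)
      then have "n + r < p * p" by (simp only: of_nat_less_iff)
      then have "p \<le> 2 ^ (n div p) * (n div p + r div p + 1) ^ (n div p + 1)"
        using S r p by (intro S_sum_Ints_imp_prime_le) auto
      moreover have am: "n div p + r div p + 1 \<le> m"
      proof -
        have p0: "real p > 0" using pq by simp
        have "real (n div p + r div p) \<le> real n / real p + real r / real p"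
          using of_nat_div_le_of_nat[of n p, where 'a = real] of_nat_div_le_of_nat[of r p, where 'a = real]
          by simp
        also have "\<dots> = real (n + r) / real p" by (simp add: add_divide_distrib)
        also have "\<dots> \<le> (1 + E) / \<eta>"
        proof -
          have "real (n + r) * \<eta> \<le> (1 + E) * (\<eta> * real n)"
            using mult_right_mono[OF up, of \<eta>] \<eta> by (simp add: mult_ac)
          also have "\<dots> \<le> (1 + E) * real p" using pn E by (intro mult_left_mono) auto
          finally show ?thesis using p0 \<eta> by (simp add: divide_le_eq le_divide_eq mult.commute)
        qed
        finally have "real (n div p + r div p) \<le> (1 + E) / \<eta>" .
        then show ?thesis unfolding m_def by linarith
      qed
      have "2 ^ (n div p) * (n div p + r div p + 1) ^ (n div p + 1) \<le> 2 ^ m * m ^ (m + 1)"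
      proof (rule mult_le_mono)
        show "(2::nat) ^ (n div p) \<le> 2 ^ m" using am by (intro power_increasing) auto
        have "(n div p + r div p + 1) ^ (n div p + 1) \<le> m ^ (n div p + 1)"
          using am by (rule power_mono) simp
        also have "\<dots> \<le> m ^ (m + 1)" using am by (intro power_increasing) auto
        finally show "(n div p + r div p + 1) ^ (n div p + 1) \<le> m ^ (m + 1)" .
      qed
      ultimately have "p \<le> H" by (simp add: H_def)
      then show False using pn c(3) by linarith
    qed
    then have "prime_factors (n + r choose n) \<subseteq> {p. prime p \<and> p \<le> q}" by auto
    then have "(n + r choose n) \<le> (n + r) ^ card {p. prime p \<and> p \<le> q}"
      using c(5) by (intro divisor_binomial_le[of _ _ n]) auto
    then have "real (n + r choose n) \<le> real ((n + r) ^ prime_count q)"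
      unfolding prime_count_def by (rule of_nat_mono)
    then have "ln (real (n + r choose n)) \<le> ln (real ((n + r) ^ prime_count q))"
      using c(5) by (subst ln_le_cancel_iff) auto
    also have "\<dots> = real (prime_count q) * ln (real (n + r))"
      using c(5) by (simp add: ln_realpow)
    also have "\<dots> \<le> real (prime_count q) * (2 * ln (real q))"
    proof (intro mult_left_mono)
      have "ln (real (n + r)) \<le> ln ((real q)\<^sup>2)"
        using nrq c(5) q2 by (subst ln_le_cancel_iff) auto
      then show "ln (real (n + r)) \<le> 2 * ln (real q)" using q2 by (simp add: ln_realpow)
    qed simp
    also have "\<dots> \<le> 5 * real q / ln (real q) * (2 * ln (real q))"
      using q2 by (intro mult_right_mono prime_count_le) auto
    also have "\<dots> = 10 * real q" using q2 by simp
    also have "\<dots> \<le> 10 * (\<eta> * real n)" using q(2) by simp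
    also have "\<dots> = real n * h / 2" by (simp add: \<eta>_def)
    finally have 1: "ln (real (n + r choose n)) \<le> real n * h / 2" .
    have "h \<le> ln (real (n + r) / real n)"
      unfolding h_def
    proof (subst ln_le_cancel_iff)
      have "1 / E \<le> real r / real n" using nr c(5) E by (simp add: field_simps)
      then show "1 + 1 / E \<le> real (n + r) / real n" using c(5) by (simp add: add_divide_distrib)
    qed (use E c(5) in \<open>auto intro!: add_pos_pos divide_pos_pos\<close>)
    also have "\<dots> = ln (real (n + r)) - ln (real n)" using c(5) by (simp add: ln_div)
    finally have "real n * h \<le> real n * (ln (real (n + r)) - ln (real n))"
      by (intro mult_left_mono) auto
    also have "\<dots> \<le> ln (real (n + r choose n))"
      using c(5) by (intro ln_binomial_ge) auto
    finally have "real n * h \<le> real n * h / 2" using 1 by linarith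
    moreover have "real n * h > 0" using h c(5) by simp
    ultimately show False by linarith
  qed
qed

section \<open>Counting\<close>

lemma card_vimage_Suc_le: "finite F \<Longrightarrow> card {n. Suc n \<in> F} \<le> card F"
proof -
  assume "finite F"
  moreover have "{n. Suc n \<in> F} \<subseteq> (\<lambda>N. N - 1) ` F" by force
  ultimately show ?thesis by (rule surj_card_le)
qed

lemma card_S_set_interval_le:
  obtains N0 where "N0 \<ge> 1" and
    "\<And>X w. exp 10 \<le> real w \<Longrightarrow> X \<ge> 1 \<Longrightarrow> real (card (S_set \<inter> {N0..X})) \<le>
      real (card {N \<in> {1..X + 1}. prime_factors N \<subseteq> {p. prime p \<and> p \<le> w * w}}) +
      4 * real (X + 1) / real w + ln (real (2 * X)) * (8 * real X / real w)"
proof -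
  obtain N1 where N1: "\<And>n r. n \<ge> N1 \<Longrightarrow> r \<ge> 1 \<Longrightarrow> S_sum r n \<in> \<int> \<Longrightarrow> exp 12 * real r < real n"
    by (rule S_sum_Ints_imp_shift_small) blast
  define N0 where "N0 = max 1 N1"
  show ?thesis
  proof (rule that[of N0])
    show "N0 \<ge> 1" by (simp add: N0_def)
    fix X w :: nat assume w: "exp 10 \<le> real w" and X: "X \<ge> 1"
    define z where "z = w * w"
    define Sm where "Sm = {N \<in> {1..X + 1}. prime_factors N \<subseteq> {p. prime p \<and> p \<le> z}}"
    define T where "T = special z"
    define B where "B = {n. n \<ge> N0 \<and> (\<exists>r\<ge>z. r \<ge> 1 \<and> S_sum r n \<in> \<int>)}"
    have w0: "w > 0" using w exp_gt_zero[of "10::real"] by (cases w) auto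
    have zw: "real w \<le> real z" using w0 by (simp add: z_def)
    have L: "ln (real (2 * X)) > 0" using X by simp
    have "S_set \<inter> {N0..X} \<subseteq> {n. Suc n \<in> Sm} \<union> {n. Suc n \<in> T \<inter> {1..X + 1}} \<union> (B \<inter> {0..X})"
    proof
      fix n assume n: "n \<in> S_set \<inter> {N0..X}"
      then obtain r where r: "r \<ge> 1" "S_sum r n \<in> \<int>" by (auto simp: S_set_def)
      show "n \<in> {n. Suc n \<in> Sm} \<union> {n. Suc n \<in> T \<inter> {1..X + 1}} \<union> (B \<inter> {0..X})"
      proof (cases "z \<le> r \<or> Suc n \<in> Sm")
        case True
        then show ?thesis using n r by (auto simp: B_def)
      next
        case False
        then have "\<not> prime_factors (Suc n) \<subseteq> {p. prime p \<and> p \<le> z}"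
          using n by (auto simp: Sm_def)
        then obtain p where "p \<in> prime_factors (Suc n)" "\<not> (prime p \<and> p \<le> z)" by blast
        then have p: "prime p" "p dvd Suc n" "z < p" by (auto simp: in_prime_factors_iff)
        \<comment> \<open>Here only i = 1 is used, which is available for every r \<ge> 1; the prime
          is large enough because r < z < p.\<close>
        then have "p dvd 2 ^ (n + 1) - 1"
          using r False by (intro S_sum_Ints_imp_dvd_mersenne[of r]) auto
        then have "Suc n \<in> T" using p by (auto simp: T_def special_def)
        then show ?thesis using n by simp
      qed
    qed
    then have "card (S_set \<inter> {N0..X}) \<le>
        card ({n. Suc n \<in> Sm} \<union> {n. Suc n \<in> T \<inter> {1..X + 1}} \<union> (B \<inter> {0..X}))"
    proof (rule card_mono[rotated])
      have "finite {n. Suc n \<in> Sm}"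
        by (rule finite_subset[of _ "{..X + 1}"]) (auto simp: Sm_def)
      moreover have "finite {n. Suc n \<in> T \<inter> {1..X + 1}}"
        by (rule finite_subset[of _ "{..X + 1}"]) auto
      ultimately show "finite ({n. Suc n \<in> Sm} \<union> {n. Suc n \<in> T \<inter> {1..X + 1}} \<union> (B \<inter> {0..X}))"
        by simp
    qed
    also have "\<dots> \<le> card {n. Suc n \<in> Sm} + card {n. Suc n \<in> T \<inter> {1..X + 1}} + card (B \<inter> {0..X})"
      by (meson add_le_mono1 card_Un_le le_trans)
    also have "card {n. Suc n \<in> Sm} \<le> card Sm"
      by (rule card_vimage_Suc_le) (simp add: Sm_def)
    also have "card {n. Suc n \<in> T \<inter> {1..X + 1}} \<le> card (T \<inter> {1..X + 1})"
      by (rule card_vimage_Suc_le) simp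
    finally have "real (card (S_set \<inter> {N0..X})) \<le>
        real (card Sm) + real (card (T \<inter> {1..X + 1})) + real (card (B \<inter> {0..X}))"
      by simp
    also have "real (card (T \<inter> {1..X + 1})) \<le> 4 * real (X + 1) / real w"
      unfolding T_def z_def using w0 by (rule card_special_le)
    also have "real (card (B \<inter> {0..X})) \<le> ln (real (2 * X)) * (8 * real X / real w)"
    proof -
      \<comment> \<open>Since r \<le> n \<le> X, the intervals end at 2X at the latest, and the
        density 1 / ln(2X) serves for all of them.\<close>
      have "real (card (B \<inter> {0..X})) * (1 / ln (real (2 * X))) \<le> real (card (T \<inter> {0<..2 * X}))"
      proof (rule card_covering_le)
        fix n assume n: "n \<in> B" "n \<le> X"
        then obtain r where r: "r \<ge> 1" "r \<ge> z" "S_sum r n \<in> \<int>" "n \<ge> N0" by (auto simp: B_def)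
        have small: "exp 12 * real r < real n" using r by (intro N1) (auto simp: N0_def)
        have "real r * 1 \<le> real r * exp 12" by (intro mult_left_mono) auto
        then have rn: "r \<le> n" using small by (simp add: mult.commute)
        \<comment> \<open>The lower bound on \<open>w\<close> is there for this:
          \<open>log_gap\<close> is applied with v = ln r.\<close>
        have "real r \<ge> exp 10" using w zw r(2) by linarith
        then have "ln (real r) \<ge> 10" using r(1) by (simp add: ln_ge_iff)
        then have "real r \<le> real (card (T \<inter> {n<..n + r})) * ln (real (n + r))"
          unfolding T_def using r small by (intro S_sum_Ints_imp_many_special) auto
        also have "\<dots> \<le> real (card (T \<inter> {n<..n + r})) * ln (real (2 * X))"
          using rn r n by (intro mult_left_mono) (auto simp del: of_nat_add of_nat_mult)
        finally show "\<exists>r\<ge>1. n + r \<le> 2 * X \<and>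
            real r * (1 / ln (real (2 * X))) \<le> real (card (T \<inter> {n<..n + r}))"
          using L rn n r by (intro exI[of _ r]) (simp add: divide_le_eq)
      qed (use L in simp)
      also have "{0<..2 * X} = {1..2 * X}" by auto
      also have "real (card (T \<inter> {1..2 * X})) \<le> 4 * real (2 * X) / real w"
        unfolding T_def z_def using w0 by (rule card_special_le)
      finally have "real (card (B \<inter> {0..X})) * (1 / ln (real (2 * X))) \<le> 8 * real X / real w" by simp
      then show ?thesis using L by (simp add: divide_le_eq mult.commute)
    qed
    finally show "real (card (S_set \<inter> {N0..X})) \<le>
        real (card {N \<in> {1..X + 1}. prime_factors N \<subseteq> {p. prime p \<and> p \<le> w * w}}) +
        4 * real (X + 1) / real w + ln (real (2 * X)) * (8 * real X / real w)"
      by (simp add: Sm_def z_def)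
  qed
qed

section \<open>Choice of the parameters as powers of the logarithm\<close>

lemma eventually_card_smooth_le:
  fixes A :: real
  assumes "A > 0"
  shows "eventually (\<lambda>x. \<forall>X w. X \<ge> 1 \<and> w \<ge> 1 \<and> real X \<le> x \<and> real w \<le> 2 * ln x powr (A + 1) \<longrightarrow>
    real (card {N \<in> {1..X + 1}. prime_factors N \<subseteq> {p. prime p \<and> p \<le> w * w}}) \<le>
      2 * (x / ln x powr A)) at_top"
proof -
  \<comment> \<open>With L = ln x \<ge> 4 one has w * w \<le> 4 L^(2A+2) \<le> L^b, and \<epsilon> =
    1/(2b) makes z^\<epsilon> at most sqrt L. The saving exp(-\<epsilon> L) then absorbs both
    Rankin's factor, whose exponent is of order sqrt L * ln L, and L^A.\<close>
  define b where "b = 2 * A + 3"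
  define \<epsilon> where "\<epsilon> = 1 / (2 * b)"
  have b: "b > 0" using assms by (simp add: b_def)
  have \<epsilon>: "\<epsilon> > 0" "\<epsilon> \<le> 1 / 4" using assms by (auto simp: \<epsilon>_def b_def field_simps)
  have b\<epsilon>: "b * \<epsilon> = 1 / 2" using b by (simp add: \<epsilon>_def)
  have "eventually (\<lambda>L::real. 3 * sqrt L * (1 + b * ln L) + A * ln L \<le> \<epsilon> * L \<and> 4 \<le> L) at_top"
  proof (rule eventually_conj)
    show "eventually (\<lambda>L::real. 3 * sqrt L * (1 + b * ln L) + A * ln L \<le> \<epsilon> * L) at_top"
      using \<epsilon>(1) b assms by real_asymp
    show "eventually (\<lambda>L::real. 4 \<le> L) at_top" by (rule eventually_ge_at_top)
  qed
  then have "eventually (\<lambda>x::real. 3 * sqrt (ln x) * (1 + b * ln (ln x)) + A * ln (ln x) \<le> \<epsilon> * ln x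
      \<and> 4 \<le> ln x) at_top"
    using ln_at_top by (rule eventually_compose_filterlim)
  moreover have "eventually (\<lambda>x::real. x \<ge> 2) at_top" by (rule eventually_ge_at_top)
  ultimately show ?thesis
  proof eventually_elim
    case (elim x)
    define L where "L = ln x"
    have L: "L \<ge> 4" "3 * sqrt L * (1 + b * ln L) + A * ln L \<le> \<epsilon> * L"
      using elim by (auto simp: L_def)
    have x: "x = exp L" using elim by (simp add: L_def)
    show ?case
    proof (intro allI impI)
      fix X w :: nat assume Xw: "X \<ge> 1 \<and> w \<ge> 1 \<and> real X \<le> x \<and> real w \<le> 2 * ln x powr (A + 1)"
      define z where "z = w * w"
      have "real z \<le> (2 * L powr (A + 1)) * (2 * L powr (A + 1))"
        unfolding z_def of_nat_mult using Xw by (intro mult_mono) (auto simp: L_def)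
      also have "\<dots> = 4 * L powr (2 * A + 2)" by (simp add: powr_add[symmetric])
      also have "\<dots> \<le> L * L powr (2 * A + 2)" using L by (intro mult_right_mono) auto
      also have "\<dots> = L powr b" using L by (simp add: b_def powr_mult_base add.commute)
      finally have z: "real z \<le> L powr b" .
      have z1: "z \<ge> 1" using Xw by (simp add: z_def Suc_le_eq)
      have "real z powr \<epsilon> \<le> (L powr b) powr \<epsilon>"
        using z \<epsilon> by (intro powr_mono2) auto
      also have "\<dots> = sqrt L" using L by (simp add: powr_powr b\<epsilon> powr_half_sqrt)
      finally have z\<epsilon>: "real z powr \<epsilon> \<le> sqrt L" .
      have "ln (real z) \<le> ln (L powr b)" using z z1 by (subst ln_le_cancel_iff) auto
      then have lnz: "ln (real z) \<le> b * ln L" using L by (simp add: ln_powr)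
      have "real (card {N \<in> {1..X + 1}. prime_factors N \<subseteq> {p. prime p \<and> p \<le> z}}) \<le>
          real (X + 1) powr (1 - \<epsilon>) * exp (3 * real z powr \<epsilon> * (1 + ln (real z)))"
        using \<epsilon> z1 by (intro card_smooth_le) auto
      also have "\<dots> \<le> (2 * exp (L * (1 - \<epsilon>))) * exp (3 * sqrt L * (1 + b * ln L))"
      proof (intro mult_mono)
        have "real (X + 1) powr (1 - \<epsilon>) \<le> (2 * x) powr (1 - \<epsilon>)"
          using Xw \<epsilon> by (intro powr_mono2) auto
        also have "\<dots> = 2 powr (1 - \<epsilon>) * exp (L * (1 - \<epsilon>))"
          using elim by (simp add: powr_mult powr_def[of x] L_def mult.commute)
        also have "2 powr (1 - \<epsilon>) \<le> 2 powr (1::real)" using \<epsilon> by (intro powr_mono) auto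
        finally show "real (X + 1) powr (1 - \<epsilon>) \<le> 2 * exp (L * (1 - \<epsilon>))" by simp
        have "3 * real z powr \<epsilon> * (1 + ln (real z)) \<le> 3 * sqrt L * (1 + b * ln L)"
          using z\<epsilon> lnz z1 L by (intro mult_mono) auto
        then show "exp (3 * real z powr \<epsilon> * (1 + ln (real z))) \<le> exp (3 * sqrt L * (1 + b * ln L))"
          by simp
      qed auto
      also have "\<dots> = 2 * exp (L * (1 - \<epsilon>) + 3 * sqrt L * (1 + b * ln L))"
        by (simp add: exp_add)
      also have "\<dots> \<le> 2 * exp (L - A * ln L)" using L(2) by (simp add: algebra_simps)
      also have "\<dots> = 2 * (x / ln x powr A)"
        using L(1) by (simp add: exp_diff x powr_def)
      finally show "real (card {N \<in> {1..X + 1}. prime_factors N \<subseteq> {p. prime p \<and> p \<le> w * w}}) \<le>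
          2 * (x / ln x powr A)" by (simp add: z_def)
    qed
  qed
qed

text \<open>The constant is 27 = 1 + 2 + 8 + 16, for the n below \<open>N0\<close>, the smooth n +
  1, the special n + 1 and the n with a large shift.\<close>

lemma eventually_card_S_upto_le:
  fixes A :: real
  assumes A: "A > 0"
  shows "eventually (\<lambda>x. real (card (S_upto x)) \<le> 27 * (x / ln x powr A)) at_top"
proof -
  obtain N0 where N0: "N0 \<ge> 1"
    "\<And>X w. exp 10 \<le> real w \<Longrightarrow> X \<ge> 1 \<Longrightarrow> real (card (S_set \<inter> {N0..X})) \<le>
      real (card {N \<in> {1..X + 1}. prime_factors N \<subseteq> {p. prime p \<and> p \<le> w * w}}) +
      4 * real (X + 1) / real w + ln (real (2 * X)) * (8 * real X / real w)"
    by (rule card_S_set_interval_le) blast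
  have "eventually (\<lambda>x::real. exp 10 \<le> ln x powr (A + 1)) at_top" using A by real_asymp
  moreover have "eventually (\<lambda>x::real. real N0 \<le> x / ln x powr A) at_top" using A by real_asymp
  moreover have "eventually (\<lambda>x::real. 2 \<le> x) at_top" by (rule eventually_ge_at_top)
  moreover have "eventually (\<lambda>x::real. 1 \<le> ln x) at_top" by real_asymp
  ultimately show ?thesis using eventually_card_smooth_le[OF A]
  proof eventually_elim
    case (elim x)
    define L where "L = ln x"
    have L: "L \<ge> 1" using elim by (simp add: L_def)
    define X where "X = nat \<lfloor>x\<rfloor>"
    \<comment> \<open>One power of \<open>L\<close> more than \<open>A\<close>, because the covering
      loses the factor ln(2X) \<le> 2L.\<close>
    define w where "w = nat \<lceil>L powr (A + 1)\<rceil>"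
    have X: "X \<ge> 1" "real X \<le> x" "x < real X + 1"
      using elim unfolding X_def by linarith+
    have L1: "L powr (A + 1) \<ge> 1" using L A by (simp add: ge_one_powr_ge_zero)
    have w: "L powr (A + 1) \<le> real w" "real w \<le> 2 * L powr (A + 1)"
      using L1 unfolding w_def by linarith+
    have w10: "exp 10 \<le> real w" using elim w by (simp add: L_def)
    have w1: "w \<ge> 1" using L1 w by linarith
    have LA: "L powr (A + 1) = L * L powr A" using L by (simp add: powr_mult_base add.commute)
    have pos: "L powr (A + 1) > 0" "L powr A > 0" using L by auto
    have "S_upto x \<subseteq> {..<N0} \<union> (S_set \<inter> {N0..X})"
    proof
      fix n assume n: "n \<in> S_upto x"
      then have "n < X + 1" using X(3) by (auto simp: S_upto_def)
      then show "n \<in> {..<N0} \<union> (S_set \<inter> {N0..X})" using n by (auto simp: S_upto_def)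
    qed
    then have "card (S_upto x) \<le> card ({..<N0} \<union> (S_set \<inter> {N0..X}))"
      by (intro card_mono) auto
    also have "\<dots> \<le> N0 + card (S_set \<inter> {N0..X})"
      using card_Un_le[of "{..<N0}" "S_set \<inter> {N0..X}"] by simp
    finally have "real (card (S_upto x)) \<le> real N0 + real (card (S_set \<inter> {N0..X}))" by simp
    also have "real (card (S_set \<inter> {N0..X})) \<le>
        real (card {N \<in> {1..X + 1}. prime_factors N \<subseteq> {p. prime p \<and> p \<le> w * w}}) +
        4 * real (X + 1) / real w + ln (real (2 * X)) * (8 * real X / real w)"
      by (rule N0(2)[OF w10 X(1)])
    also have "real (card {N \<in> {1..X + 1}. prime_factors N \<subseteq> {p. prime p \<and> p \<le> w * w}}) \<le>
        2 * (x / L powr A)"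
      using elim(5) X w w1 by (simp add: L_def)
    also have "4 * real (X + 1) / real w \<le> 8 * (x / L powr A)"
    proof -
      have "4 * real (X + 1) / real w \<le> (8 * x) / L powr A"
      proof (rule frac_le)
        have "L powr A \<le> L powr (A + 1)" using L by (intro powr_mono) auto
        then show "L powr A \<le> real w" using w by linarith
      qed (use X pos elim in auto)
      then show ?thesis by simp
    qed
    also have "ln (real (2 * X)) * (8 * real X / real w) \<le> 16 * (x / L powr A)"
    proof -
      have "ln (real (2 * X)) \<le> ln (x * x)"
        using X elim by (subst ln_le_cancel_iff) (auto intro!: mult_mono mult_pos_pos)
      also have "\<dots> = 2 * L" using elim by (simp add: L_def ln_mult)
      finally have l: "ln (real (2 * X)) \<le> 2 * L" .
      have "8 * real X / real w \<le> 8 * x / L powr (A + 1)"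
        using X w pos elim by (intro frac_le) auto
      with l have "ln (real (2 * X)) * (8 * real X / real w) \<le> 2 * L * (8 * x / L powr (A + 1))"
        using X L by (intro mult_mono) auto
      also have "\<dots> = 16 * (x / L powr A)" using L pos by (simp add: LA)
      finally show ?thesis .
    qed
    also have "real N0 \<le> x / L powr A" using elim by (simp add: L_def)
    finally show ?case by (simp add: L_def)
  qed
qed

section \<open>From large x to all x \<ge> 2, and the reciprocal sum\<close>

lemma card_S_upto_bound:
  fixes A :: real
  assumes A: "A > 0"
  obtains C where "\<And>x. x \<ge> 2 \<Longrightarrow> real (card (S_upto x)) \<le> C * (x / ln x powr A)"
proof -
  obtain x0 where x0: "\<And>x. x \<ge> x0 \<Longrightarrow> real (card (S_upto x)) \<le> 27 * (x / ln x powr A)"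
    using eventually_card_S_upto_le[OF A] by (auto simp: eventually_at_top_linorder)
  define y where "y = max 2 x0"
  \<comment> \<open>For x below \<open>x0\<close> the trivial bound \<open>card (S_upto x)\<close>
    \<le> x suffices, as \<open>C\<close> is at least (ln x)^A there.\<close>
  define C where "C = max 27 (ln y powr A)"
  show ?thesis
  proof (rule that[of C])
    fix x :: real assume x: "x \<ge> 2"
    have pos: "x / ln x powr A > 0" using x by simp
    show "real (card (S_upto x)) \<le> C * (x / ln x powr A)"
    proof (cases "x \<ge> x0")
      case True
      have "27 * (x / ln x powr A) \<le> C * (x / ln x powr A)"
        using pos by (intro mult_right_mono) (auto simp: C_def)
      then show ?thesis using x0[OF True] by linarith
    next
      case False
      then have "ln x \<le> ln y" using x by (subst ln_le_cancel_iff) (auto simp: y_def)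
      then have "ln x powr A \<le> ln y powr A" using x A by (intro powr_mono2) auto
      also have "\<dots> \<le> C" by (simp add: C_def)
      finally have "x * ln x powr A \<le> x * C" using x by (intro mult_left_mono) auto
      then have "x \<le> C * (x / ln x powr A)"
        using x by (simp add: le_divide_eq mult.commute)
      moreover have "real (card (S_upto x)) \<le> x"
      proof -
        have "S_upto x \<subseteq> {1..nat \<lfloor>x\<rfloor>}"
          by (auto simp: S_upto_def le_nat_floor)
        then have "card (S_upto x) \<le> nat \<lfloor>x\<rfloor>"
          using card_mono[of "{1..nat \<lfloor>x\<rfloor>}"] by fastforce
        then show ?thesis using x by linarith
      qed
      ultimately show ?thesis by linarith
    qed
  qed
qed

text \<open>Dyadic blocks: 1/n is at most 2^(-k) on [2^k, 2^(k+1)), and the count there is of order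
  2^k / (k+1)^2, so the block sums are dominated by a convergent series.\<close>

lemma summable_on_reciprocals_if_sparse:
  fixes S :: "nat set" and C :: real
  assumes S0: "0 \<notin> S"
    and C: "\<And>x. x \<ge> 2 \<Longrightarrow> real (card {n \<in> S. real n \<le> x}) \<le> C * (x / ln x powr 2)"
  shows "(\<lambda>n. 1 / real n) summable_on S"
proof (rule nonneg_bdd_above_summable_on)
  define D where "D k = {n \<in> S. 2 ^ k \<le> n \<and> n < 2 ^ Suc k}" for k :: nat
  have finD: "finite (D k)" for k
    by (rule finite_subset[of _ "{..<2 ^ Suc k}"]) (auto simp: D_def)
  define K where "K = 2 * C / (ln 2)\<^sup>2"
  have D: "(\<Sum>n\<in>D k. 1 / real n) \<le> K * (1 / real (Suc k) ^ 2)" for k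
  proof -
    have "(\<Sum>n\<in>D k. 1 / real n) \<le> (\<Sum>n\<in>D k. 1 / 2 ^ k)"
    proof (rule sum_mono)
      fix n assume "n \<in> D k"
      then have "real (2 ^ k) \<le> real n" unfolding D_def by (intro of_nat_mono) simp
      then have "2 ^ k \<le> real n" by simp
      then show "1 / real n \<le> 1 / 2 ^ k" by (intro frac_le) auto
    qed
    also have "\<dots> = real (card (D k)) / 2 ^ k" by simp
    also have "card (D k) \<le> card {n \<in> S. real n \<le> 2 ^ Suc k}"
    proof (rule card_mono)
      show "finite {n \<in> S. real n \<le> 2 ^ Suc k}"
        by (rule finite_subset[of _ "{..2 ^ Suc k}"])
          (auto simp: of_nat_le_iff[of _ "2 ^ Suc k", where 'a = real, simplified])
      show "D k \<subseteq> {n \<in> S. real n \<le> 2 ^ Suc k}"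
      proof
        fix n assume "n \<in> D k"
        then have "n \<in> S" "n \<le> 2 ^ Suc k" unfolding D_def by auto
        then have "real n \<le> real (2 ^ Suc k)" by (intro of_nat_mono)
        with \<open>n \<in> S\<close> have "n \<in> S" "real n \<le> real (2 ^ Suc k)" by blast+
        then show "n \<in> {n \<in> S. real n \<le> 2 ^ Suc k}" by simp
      qed
    qed
    then have "real (card (D k)) / 2 ^ k \<le> real (card {n \<in> S. real n \<le> 2 ^ Suc k}) / 2 ^ k"
      by (intro divide_right_mono) auto
    also have "\<dots> \<le> C * (2 ^ Suc k / ln (2 ^ Suc k) powr 2) / 2 ^ k"
      by (intro divide_right_mono C) auto
    also have "\<dots> = K * (1 / real (Suc k) ^ 2)"
    proof -
      have "ln (2 ^ Suc k) = real (Suc k) * ln (2::real)" by (rule ln_realpow)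
      then have "ln (2 ^ Suc k) powr 2 = (real (Suc k))\<^sup>2 * (ln (2::real))\<^sup>2"
        by (simp only:) (simp add: power_mult_distrib)
      then show ?thesis by (simp only: K_def) (simp add: mult.commute)
    qed
    finally show ?thesis .
  qed
  have summ: "summable (\<lambda>k. 1 / real (Suc k) ^ 2)"
    using inverse_power_summable[of 2, where 'a = real]
    by (subst summable_Suc_iff) (simp add: inverse_eq_divide)
  \<comment> \<open>The sign of \<open>C\<close> is not among the assumptions; block 0 determines
    it.\<close>
  have K0: "K \<ge> 0"
  proof -
    have "0 \<le> (\<Sum>n\<in>D 0. 1 / real n)" by (intro sum_nonneg) auto
    then show ?thesis using D[of 0] by simp
  qed
  show "bdd_above (sum (\<lambda>n. 1 / real n) ` {F. F \<subseteq> S \<and> finite F})"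
  proof (rule bdd_aboveI2)
    fix F assume F: "F \<in> {F. F \<subseteq> S \<and> finite F}"
    then obtain m where m: "F \<subseteq> {..<m}" using finite_nat_iff_bounded by auto
    have "F \<subseteq> (\<Union>k\<in>{..<m}. D k)"
    proof
      fix n assume n: "n \<in> F"
      then have n0: "n > 0" using F S0 by (cases n) auto
      obtain k where k: "2 ^ k \<le> n" "n < 2 ^ Suc k"
        using ex_power_ivl1[of 2 n] n0 by auto
      have "k < 2 ^ k" by simp
      then have "k < m" using k n m by (meson lessThan_iff less_le_trans less_trans not_le subsetD)
      then show "n \<in> (\<Union>k\<in>{..<m}. D k)" using k n F by (auto simp: D_def)
    qed
    then have "(\<Sum>n\<in>F. 1 / real n) \<le> (\<Sum>n\<in>(\<Union>k\<in>{..<m}. D k). 1 / real n)"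
      using finD by (intro sum_mono2) auto
    also have "\<dots> = (\<Sum>k<m. \<Sum>n\<in>D k. 1 / real n)"
    proof (intro sum.UNION_disjoint ballI impI)
      have "D i \<inter> D j = {}" if "i < j" for i j
      proof -
        have "(2::nat) ^ Suc i \<le> 2 ^ j" using that by (intro power_increasing) auto
        then have "\<not> (n < 2 ^ Suc i \<and> 2 ^ j \<le> n)" for n :: nat by linarith
        then show ?thesis unfolding D_def by blast
      qed
      then show "D i \<inter> D j = {}" if "i \<noteq> j" for i j
        using that by (metis Int_commute linorder_neqE_nat)
    qed (use finD in auto)
    also have "\<dots> \<le> (\<Sum>k<m. K * (1 / real (Suc k) ^ 2))" by (intro sum_mono D)
    also have "\<dots> = K * (\<Sum>k<m. 1 / real (Suc k) ^ 2)" by (simp only: sum_distrib_left)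
    also have "\<dots> \<le> K * (\<Sum>k. 1 / real (Suc k) ^ 2)"
      using K0 by (intro mult_left_mono sum_le_suminf summ) auto
    finally show "(\<Sum>n\<in>F. 1 / real n) \<le> K * (\<Sum>k. 1 / real (Suc k) ^ 2)" .
  qed
qed auto

theorem mainTheorem2:
  shows "(\<forall>A::real. A > 0 \<longrightarrow>
            (\<exists>C::real. \<forall>x::real. x \<ge> 2 \<longrightarrow>
               real (card (S_upto x)) \<le> C * (x / (ln x) powr A)))
         \<and> (\<lambda>n::nat. 1 / real n) summable_on S_set"
proof (intro conjI allI impI)
  fix A :: real assume "A > 0"
  then obtain C where "\<And>x. x \<ge> 2 \<Longrightarrow> real (card (S_upto x)) \<le> C * (x / ln x powr A)"
    by (rule card_S_upto_bound) blast
  then show "\<exists>C. \<forall>x\<ge>2. real (card (S_upto x)) \<le> C * (x / ln x powr A)" by blast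
next
  obtain C where C: "\<And>x. x \<ge> 2 \<Longrightarrow> real (card (S_upto x)) \<le> C * (x / ln x powr 2)"
    using card_S_upto_bound[of 2] by auto
  have "S_upto x = {n \<in> S_set. real n \<le> x}" for x
    by (auto simp: S_upto_def S_set_def)
  then show "(\<lambda>n. 1 / real n) summable_on S_set"
    using C by (intro summable_on_reciprocals_if_sparse[of _ C]) (auto simp: S_set_def)
qed

end
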